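(* Let $n>d\ge 1$, let $A\in\mathbb{R}^{n\times d}$ have rank $r$, let $\tilde A = Q_\rho(A)=A+E$ be the entrywise stochastic rounding of $A$ with resolution $\rho$, and let $\nu,\mu,\kappa$ be the normalized variance parameters of $E$. Suppose $\kappa\ge \log n$. Then for every $a>0$ there exist a constant $C_a>0$ depending only on $a$, and absolute constants $C_1>0$, $c_1>0$, such that for every $u\ge 0$, $$\mathbb{P}\left\{\sigma_d(\tilde A)\ \ge\ \rho\left(\sqrt{n\nu}-\sqrt{\mu}-C_a\,\kappa^{1/3}(\log n)^{2/3}-C_1\left(\sqrt{d+r}+u\right)\right)\right\}\ \ge\ 1-n^{-a}-2e^{-c_1u^2}.$$ (The constants do not depend on $n,d,r,A,\rho,u$.)
   Context: Stochastic rounding (uniformly dithered quantizer): given $R>0$ with $|A_{ij}|\le R$ for all $i,j$ and an integer bit-budget $B\ge 1$, let $M=2^B$, let $q_1<\dots<q_M$ be evenly spaced points with $q_1=-R$, $q_M=R$, and let $\rho=2R/(M-1)$ be the spacing (resolution). For $x\in[q_k,q_{k+1}]$, $Q_\rho(x)=q_{k+1}$ with probability $(x-q_k)/\rho$ and $Q_\rho(x)=q_k$ otherwise. The matrix $\tilde A$ has entries $\tilde A_{ij}=Q_\rho(A_{ij})$, rounded independently over $(i,j)$, and $E=\tilde A-A$. Thus the entries of $E$ are independent, centered, satisfy $|E_{ij}|\le\rho$, and $\mathrm{Var}(E_{ij})\le\rho^2/4$. Variance parameters: $\nu_j=\sum_{i=1}^n\mathrm{Var}(E_{ij})$ for $1\le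 j\le d$; $\nu=\frac{1}{n\rho^2}\min_j\nu_j$; $\bar\nu=\frac1{n\rho^2}\max_j\nu_j$; $\mu=\frac1{\rho^2}\max_{1\le i\le n}\sum_{j=1}^d\mathrm{Var}(E_{ij})$; $\kappa=\max\{\mu,n\bar\nu\}$. $\sigma_d(\cdot)$ denotes the $d$-th largest (smallest) singular value of an $n\times d$ matrix. *)

theory Defs
  imports
    "HOL-Probability.Probability"
    "HOL-Computational_Algebra.Computational_Algebra"
    "Jordan_Normal_Form.DL_Rank"
    "Jordan_Normal_Form.Char_Poly"
begin

text \<open>
  Matrices are those of \<^theory>\<open>Jordan_Normal_Form.Matrix\<close>, with dimensions as values, because the
  constants in the main statement have to be chosen before the dimensions. Rows and columns are
  indexed from 0; grid points and singular values are indexed from 1.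
\<close>

text \<open>Stochastic rounding\<close>

definition resolution :: "real \<Rightarrow> nat \<Rightarrow> real" where
  "resolution R B = 2 * R / (2 ^ B - 1)"

definition grid_point :: "real \<Rightarrow> nat \<Rightarrow> nat \<Rightarrow> real" where
  "grid_point R B k = - R + (real k - 1) * resolution R B"

text \<open>
  An interior grid point lies in two cells; \<open>stoch_round_eq\<close> below shows that the choice of the
  cell does not affect the distribution.
\<close>

definition grid_cell :: "real \<Rightarrow> nat \<Rightarrow> real \<Rightarrow> nat" where
  "grid_cell R B x =
    (LEAST k. k \<in> {1..<2 ^ B} \<and> x \<in> {grid_point R B k..grid_point R B (k + 1)})"

definition stoch_round :: "real \<Rightarrow> nat \<Rightarrow> real \<Rightarrow> real pmf" where
  "stoch_round R B x =
    (let k = grid_cell R B x in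
      map_pmf (\<lambda>up. if up then grid_point R B (k + 1) else grid_point R B k)
        (bernoulli_pmf ((x - grid_point R B k) / resolution R B)))"

text \<open>
  The law of the randomly rounded matrix: all entries are rounded independently.
\<close>

definition stoch_round_mat :: "real \<Rightarrow> nat \<Rightarrow> real mat \<Rightarrow> real mat pmf" where
  "stoch_round_mat R B A =
    map_pmf (Matrix.mat (dim_row A) (dim_col A))
      (Pi_pmf ({..<dim_row A} \<times> {..<dim_col A}) 0 (\<lambda>ij. stoch_round R B (A $$ ij)))"

text \<open>Normalized variance parameters of the rounding error\<close>

definition err_var :: "real \<Rightarrow> nat \<Rightarrow> real mat \<Rightarrow> nat \<Rightarrow> nat \<Rightarrow> real" where
  "err_var R B A i j = measure_pmf.variance (stoch_round_mat R B A) (\<lambda>A'. (A' - A) $$ (i, j))"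

definition col_var :: "real \<Rightarrow> nat \<Rightarrow> real mat \<Rightarrow> nat \<Rightarrow> real" where
  "col_var R B A j = (\<Sum>i<dim_row A. err_var R B A i j)"

definition row_var :: "real \<Rightarrow> nat \<Rightarrow> real mat \<Rightarrow> nat \<Rightarrow> real" where
  "row_var R B A i = (\<Sum>j<dim_col A. err_var R B A i j)"

definition nu :: "real \<Rightarrow> nat \<Rightarrow> real mat \<Rightarrow> real" where
  "nu R B A = 1 / (real (dim_row A) * (resolution R B)\<^sup>2) * Min (col_var R B A ` {..<dim_col A})"

definition nu_bar :: "real \<Rightarrow> nat \<Rightarrow> real mat \<Rightarrow> real" where
  "nu_bar R B A = 1 / (real (dim_row A) * (resolution R B)\<^sup>2) * Max (col_var R B A ` {..<dim_col A})"

definition mu :: "real \<Rightarrow> nat \<Rightarrow> real mat \<Rightarrow> real" where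
  "mu R B A = 1 / (resolution R B)\<^sup>2 * Max (row_var R B A ` {..<dim_row A})"

definition kappa :: "real \<Rightarrow> nat \<Rightarrow> real mat \<Rightarrow> real" where
  "kappa R B A = max (mu R B A) (real (dim_row A) * nu_bar R B A)"

text \<open>
  The singular values in decreasing order: square roots of the eigenvalues of the Gram matrix,
  counted with multiplicity. As the Gram matrix is symmetric, its characteristic polynomial splits
  over the reals and the list has length \<^term>\<open>dim_col A\<close>.
\<close>

definition singular_values :: "real mat \<Rightarrow> real list" where
  "singular_values A =
    rev (sorted_list_of_multiset (image_mset sqrt (proots (char_poly (transpose_mat A * A)))))"

definition singular_value :: "nat \<Rightarrow> real mat \<Rightarrow> real" where
  "singular_value k A = singular_values A ! (k - 1)"

lemma resolution_pos:
  assumes "R > 0" "B \<ge> 1"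
  shows "resolution R B > 0"
proof -
  have "(2::real) ^ B > 1" using assms by (intro one_less_power) auto
  thus ?thesis using assms by (simp add: resolution_def)
qed

lemma grid_point_ends:
  assumes "B \<ge> 1"
  shows "grid_point R B 1 = - R" "grid_point R B (2 ^ B) = R"
proof -
  have "(2::real) ^ B > 1" using assms by (intro one_less_power) auto
  thus "grid_point R B 1 = - R" "grid_point R B (2 ^ B) = R"
    by (auto simp: grid_point_def resolution_def)
qed

lemma stoch_round_eq:
  assumes R: "R > 0" and B: "B \<ge> 1" and k: "1 \<le> k" "k < 2 ^ B"
    and x: "grid_point R B k \<le> x" "x \<le> grid_point R B (k + 1)"
  shows "stoch_round R B x =
    map_pmf (\<lambda>up. if up then grid_point R B (k + 1) else grid_point R B k)
      (bernoulli_pmf ((x - grid_point R B k) / resolution R B))"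
proof -
  let ?P = "\<lambda>k. k \<in> {1..<2 ^ B} \<and> x \<in> {grid_point R B k..grid_point R B (k + 1)}"
  define l where "l = grid_cell R B x"
  have Pk: "?P k" using k x by auto
  have Pl: "?P l" and le: "l \<le> k"
    unfolding l_def grid_cell_def using LeastI[of ?P k] Least_le[of ?P k] Pk by blast+
  have rho: "resolution R B > 0" using R B by (rule resolution_pos)
  have "grid_point R B k \<le> grid_point R B (l + 1)" using Pl x by auto
  hence "real k - 1 \<le> real l"
    using rho by (simp add: grid_point_def)
  hence "l = k \<or> k = l + 1" using le by auto
  thus ?thesis
  proof
    assume "l = k"
    thus ?thesis by (simp add: stoch_round_def Let_def l_def)
  next
    assume kl: "k = l + 1"
    hence xk: "x = grid_point R B k" using Pl x by auto
    have *: "(x - grid_point R B l) / resolution R B = 1"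
      using rho by (simp add: xk kl grid_point_def algebra_simps)
    have b1: "bernoulli_pmf 1 = return_pmf True"
    proof (rule pmf_eqI)
      show "pmf (bernoulli_pmf 1) i = pmf (return_pmf True) i" for i
        by (cases i) simp_all
    qed
    have b0: "bernoulli_pmf 0 = return_pmf False"
    proof (rule pmf_eqI)
      show "pmf (bernoulli_pmf 0) i = pmf (return_pmf False) i" for i
        by (cases i) simp_all
    qed
    have "stoch_round R B x = return_pmf x"
      unfolding stoch_round_def Let_def l_def[symmetric] * b1 by (simp add: xk kl)
    moreover have "map_pmf (\<lambda>up. if up then grid_point R B (k + 1) else grid_point R B k)
        (bernoulli_pmf ((x - grid_point R B k) / resolution R B)) = return_pmf x"
      by (simp add: xk b0)
    ultimately show ?thesis by simp
  qed
qed

end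

theory Submission
  imports Defs
begin

text \<open>
  Let \<open>v\<close> be an orthonormal basis of the range of \<open>A\<close>. Projecting \<open>(A + E) x\<close> onto the orthogonal
  complement of the range kills \<open>A\<close>, so \<open>\<parallel>(A + E) x\<parallel>\<^sup>2 \<ge> \<parallel>E x\<parallel>\<^sup>2 - \<parallel>V\<^sup>T E x\<parallel>\<^sup>2\<close>. Shrinking the columns of \<open>E\<close>
  until all column variances are equal to the smallest one, \<open>N\<close>, only decreases the smallest
  singular value. For the rescaled matrix \<open>F\<close>, with entries bounded by \<open>1\<close>, the form
  \<open>\<parallel>F x\<parallel>\<^sup>2 - N \<parallel>x\<parallel>\<^sup>2\<close> is centred; since the fourth moments of the coordinates of \<open>F x\<close> are bounded by a
  multiple of their variances, it is of order \<open>sqrt (N t) + t\<close> outside an event of probability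
  \<open>exp (- t)\<close> for fixed \<open>x\<close>, while \<open>\<parallel>V\<^sup>T F x\<parallel>\<close> is sub-Gaussian. Nets of exponential size make both
  bounds uniform for \<open>t\<close> of order \<open>d + r + u\<^sup>2\<close>, and then
  \<open>N - C (sqrt (N t) + t) \<ge> (sqrt N - C' sqrt t)\<^sup>2\<close>.
\<close>

subsection \<open>Sums of independent bounded variables\<close>

text \<open>The obstacle is that the column variances can be tiny compared with the bound
  \<open>1\<close> on the entries: an entry of \<open>A\<close> close to a grid point is hardly
  perturbed. Boundedness alone would give deviations of order \<open>sqrt (n t)\<close> for the
  squared norm of \<open>F x\<close>, which may exceed \<open>N\<close>. Replacing \<open>n\<close>
  by \<open>N\<close> requires exponential moments in which every coordinate of \<open>F x\<close>
  contributes in proportion to its variance, and this is why a fourth moment linear in the variance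
  is needed. Equal column variances serve the centring: only then is the mean of the squared norm
  the same multiple of the squared norm of \<open>x\<close> in all directions, and the fluctuation
  is governed by the smallest column variance instead of the largest. Shrinking is harmless because
  dividing the coordinates of \<open>x\<close> by factors at most \<open>1\<close> only lengthens
  \<open>x\<close>. Completing the square at the end requires \<open>sqrt N\<close> to dominate
  \<open>sqrt t\<close>. In the opposite case the asserted lower bound is not positive, and singular
  values are nonnegative.\<close>

lemma expectation_pair_pmf_finite:
  fixes f :: "'a \<times> 'b \<Rightarrow> real"
  assumes "finite (set_pmf P)" "finite (set_pmf Q)"
  shows "measure_pmf.expectation (pair_pmf P Q) f =
    measure_pmf.expectation P (\<lambda>x. measure_pmf.expectation Q (\<lambda>y. f (x, y)))"
proof -
  have "measure_pmf.expectation (pair_pmf P Q) f =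
      (\<Sum>z\<in>set_pmf P \<times> set_pmf Q. f z * pmf (pair_pmf P Q) z)"
    using assms by (intro integral_measure_pmf_real) auto
  also have "\<dots> = (\<Sum>x\<in>set_pmf P. \<Sum>y\<in>set_pmf Q. f (x, y) * (pmf P x * pmf Q y))"
    by (simp add: sum.cartesian_product) (simp add: case_prod_unfold pmf_pair[symmetric])
  also have "\<dots> = (\<Sum>x\<in>set_pmf P. (\<Sum>y\<in>set_pmf Q. f (x, y) * pmf Q y) * pmf P x)"
    by (simp add: sum_distrib_right sum_distrib_left mult_ac)
  also have "\<dots> = (\<Sum>x\<in>set_pmf P. measure_pmf.expectation Q (\<lambda>y. f (x, y)) * pmf P x)"
    using assms by (subst integral_measure_pmf_real[where M = Q and A = "set_pmf Q"]) auto
  also have "\<dots> = measure_pmf.expectation P (\<lambda>x. measure_pmf.expectation Q (\<lambda>y. f (x, y)))"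
    using assms by (intro integral_measure_pmf_real[symmetric]) auto
  finally show ?thesis .
qed

lemma finite_set_Pi_pmf:
  assumes "finite J" "\<And>j. j \<in> J \<Longrightarrow> finite (set_pmf (p j))"
  shows "finite (set_pmf (Pi_pmf J dflt p))"
  using assms by (subst set_Pi_pmf) (auto intro!: finite_PiE_dflt)

lemma expectation_Pi_pmf_insert:
  fixes g :: "('a \<Rightarrow> 'b) \<Rightarrow> real"
  assumes "finite J" "x \<notin> J" "\<And>j. j \<in> insert x J \<Longrightarrow> finite (set_pmf (p j))"
  shows "measure_pmf.expectation (Pi_pmf (insert x J) dflt p) g =
    measure_pmf.expectation (p x) (\<lambda>y. measure_pmf.expectation (Pi_pmf J dflt p) (\<lambda>w. g (w(x := y))))"
  using assms by (simp add: Pi_pmf_insert case_prod_unfold expectation_pair_pmf_finite finite_set_Pi_pmf)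

lemma expectation_Pi_pmf_union:
  fixes g h :: "('a \<Rightarrow> 'b) \<Rightarrow> real"
  assumes fin: "finite A" "finite B" "A \<inter> B = {}"
    and p: "\<And>j. j \<in> A \<union> B \<Longrightarrow> finite (set_pmf (p j))"
    and g: "\<And>w w'. (\<And>x. x \<in> A \<Longrightarrow> w x = w' x) \<Longrightarrow> g w = g w'"
    and h: "\<And>w w'. (\<And>x. x \<in> B \<Longrightarrow> w x = w' x) \<Longrightarrow> h w = h w'"
  shows "measure_pmf.expectation (Pi_pmf (A \<union> B) dflt p) (\<lambda>w. g w * h w) =
    measure_pmf.expectation (Pi_pmf A dflt p) g * measure_pmf.expectation (Pi_pmf B dflt p) h"
proof -
  have *: "g (\<lambda>x. if x \<in> A then u x else v x) = g u" "h (\<lambda>x. if x \<in> A then u x else v x) = h v" for u v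
    using fin by (auto intro!: g h)
  show ?thesis
    using fin p by (simp add: Pi_pmf_union case_prod_unfold expectation_pair_pmf_finite
        finite_set_Pi_pmf *)
qed

text \<open>This is the independence of the rows: the blocks are \<open>{i} \<times> J\<close>, and
  the hypothesis on \<open>g\<close> says that the factor \<open>g i\<close> reads row
  \<open>i\<close> only. It makes the exponential moment of a sum of squares over the rows a
  product.\<close>

lemma expectation_prod_blocks:
  fixes g :: "'i \<Rightarrow> ('i \<times> 'j \<Rightarrow> 'b) \<Rightarrow> real"
  assumes fin: "finite I" "finite J"
    and p: "\<And>ij. ij \<in> I \<times> J \<Longrightarrow> finite (set_pmf (p ij))"
    and g: "\<And>i w w'. (\<And>j. j \<in> J \<Longrightarrow> w (i, j) = w' (i, j)) \<Longrightarrow> g i w = g i w'"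
  shows "measure_pmf.expectation (Pi_pmf (I \<times> J) dflt p) (\<lambda>w. \<Prod>i\<in>I. g i w) =
    (\<Prod>i\<in>I. measure_pmf.expectation (Pi_pmf ({i} \<times> J) dflt p) (g i))"
  using fin(1) p
proof (induction I)
  case (insert i I)
  have 1: "insert i I \<times> J = ({i} \<times> J) \<union> (I \<times> J)" by auto
  have "measure_pmf.expectation (Pi_pmf (insert i I \<times> J) dflt p) (\<lambda>w. \<Prod>i\<in>insert i I. g i w)
    = measure_pmf.expectation (Pi_pmf (({i} \<times> J) \<union> (I \<times> J)) dflt p) (\<lambda>w. g i w * (\<Prod>i\<in>I. g i w))"
    using insert.hyps by (simp add: 1)
  also have "\<dots> = measure_pmf.expectation (Pi_pmf ({i} \<times> J) dflt p) (g i) *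
      measure_pmf.expectation (Pi_pmf (I \<times> J) dflt p) (\<lambda>w. \<Prod>i\<in>I. g i w)"
    using insert.hyps insert.prems fin(2)
    by (intro expectation_Pi_pmf_union prod.cong g) auto
  finally show ?case using insert.IH insert.prems insert.hyps by auto
qed simp

section \<open>Exponential moments of centred sums and of their squares\<close>

lemma Hoeffding_lemma_pmf:
  fixes f :: "'a \<Rightarrow> real"
  assumes fin: "finite (set_pmf P)" and E0: "measure_pmf.expectation P f = 0"
    and b: "\<And>y. y \<in> set_pmf P \<Longrightarrow> \<bar>f y\<bar> \<le> b"
  shows "measure_pmf.expectation P (\<lambda>y. exp (l * f y)) \<le> exp (l\<^sup>2 * b\<^sup>2 / 2)"
proof -
  have main: "measure_pmf.expectation P (\<lambda>y. exp (l * f y)) \<le> exp (l\<^sup>2 * b\<^sup>2 / 2)"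
    if l: "l > 0" and E0: "measure_pmf.expectation P f = 0" and b: "\<And>y. y \<in> set_pmf P \<Longrightarrow> \<bar>f y\<bar> \<le> b"
    for l and f :: "'a \<Rightarrow> real"
  proof -
    interpret interval_bounded_random_variable "measure_pmf P" f "-b" b
      by unfold_locales (simp, use b in \<open>fastforce simp: AE_measure_pmf_iff abs_le_iff\<close>)
    have "ennreal (measure_pmf.expectation P (\<lambda>y. exp (l * f y))) = nn_integral P (\<lambda>y. exp (l * f y))"
      by (intro nn_integral_eq_integral[symmetric] integrable_measure_pmf_finite fin) auto
    also have "\<dots> \<le> ennreal (exp (l\<^sup>2 * (b - - b)\<^sup>2 / 8))"
      by (rule Hoeffdings_lemma_nn_integral_0[OF l E0])
    also have "l\<^sup>2 * (b - - b)\<^sup>2 / 8 = l\<^sup>2 * b\<^sup>2 / 2" by (simp add: power2_eq_square)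
    finally show ?thesis by (simp add: ennreal_le_iff)
  qed
  consider "l = 0" | "l > 0" | "l < 0" by linarith
  thus ?thesis
  proof cases
    case 3
    show ?thesis using main[of "-l" "\<lambda>y. - f y"] 3 E0 b by simp
  qed (use main[of l f] E0 b in auto)
qed

text \<open>Tilting by one more summand turns the coefficient \<open>1 / t\<close> of the square into at most
  \<open>1 / (t - 2 b\<^sup>2)\<close>, so the bound survives any number of summands.\<close>
lemma expectation_exp_square_le:
  fixes f :: "'a \<Rightarrow> 'b \<Rightarrow> real"
  assumes "finite J"
    and "\<And>j. j \<in> J \<Longrightarrow> finite (set_pmf (p j))"
    and "\<And>j. j \<in> J \<Longrightarrow> measure_pmf.expectation (p j) (f j) = 0"
    and "\<And>j y. j \<in> J \<Longrightarrow> y \<in> set_pmf (p j) \<Longrightarrow> \<bar>f j y\<bar> \<le> b j"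
    and "t > 2 * (\<Sum>j\<in>J. (b j)\<^sup>2)"
  shows "measure_pmf.expectation (Pi_pmf J dflt p) (\<lambda>w. exp ((a + (\<Sum>j\<in>J. f j (w j)))\<^sup>2 / t))
    \<le> exp ((a\<^sup>2 + (\<Sum>j\<in>J. (b j)\<^sup>2)) / (t - 2 * (\<Sum>j\<in>J. (b j)\<^sup>2)))"
  using assms
proof (induction J arbitrary: a)
  case (insert x J)
  define S where "S = (\<Sum>j\<in>J. (b j)\<^sup>2)"
  define l where "l = 1 / (t - 2 * S)"
  have fin: "finite (set_pmf (p x))" using insert by auto
  have t: "t - 2 * S - 2 * (b x)\<^sup>2 > 0" using insert by (simp add: S_def)
  have tS: "t - 2 * S > 0" using t zero_le_power2[of "b x"] by linarith
  hence l: "l > 0" by (simp add: l_def)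
  have S: "S \<ge> 0" by (auto simp: S_def sum_nonneg)
  have *: "(\<Sum>j\<in>J. f j (if j = x then y else w j)) = (\<Sum>j\<in>J. f j (w j))" for y w
    using insert.hyps by (intro sum.cong) auto
  have "measure_pmf.expectation (Pi_pmf (insert x J) dflt p) (\<lambda>w. exp ((a + (\<Sum>j\<in>insert x J. f j (w j)))\<^sup>2 / t))
    = measure_pmf.expectation (p x) (\<lambda>y. measure_pmf.expectation (Pi_pmf J dflt p)
        (\<lambda>w. exp (((a + f x y) + (\<Sum>j\<in>J. f j (w j)))\<^sup>2 / t)))"
    using insert.hyps insert.prems by (subst expectation_Pi_pmf_insert) (auto simp: * add_ac)
  also have "\<dots> \<le> measure_pmf.expectation (p x) (\<lambda>y. exp (((a + f x y)\<^sup>2 + S) / (t - 2 * S)))"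
    unfolding S_def
    by (intro integral_mono integrable_measure_pmf_finite fin insert.IH)
       (use insert tS S_def in auto)
  \<comment> \<open>Bounding the square of \<open>f x y\<close> by that of \<open>b x\<close> leaves
    an exponent that is affine in \<open>f x y\<close>, so that Hoeffding's lemma applies.\<close>
  also have "\<dots> \<le> measure_pmf.expectation (p x) (\<lambda>y. exp (l * (a\<^sup>2 + (b x)\<^sup>2 + S)) * exp ((2 * a * l) * f x y))"
  proof (intro integral_mono_AE integrable_measure_pmf_finite fin, unfold AE_measure_pmf_iff, intro ballI)
    fix y assume "y \<in> set_pmf (p x)"
    hence "\<bar>f x y\<bar> \<le> \<bar>b x\<bar>" using insert.prems(3)[of x y] by auto
    hence "(f x y)\<^sup>2 \<le> (b x)\<^sup>2" by (simp add: abs_le_square_iff)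
    hence "l * ((a + f x y)\<^sup>2 + S) \<le> l * (a\<^sup>2 + (b x)\<^sup>2 + S + 2 * a * f x y)"
      using l by (intro mult_left_mono) (auto simp: power2_eq_square algebra_simps)
    thus "exp (((a + f x y)\<^sup>2 + S) / (t - 2 * S)) \<le> exp (l * (a\<^sup>2 + (b x)\<^sup>2 + S)) * exp ((2 * a * l) * f x y)"
      by (simp add: l_def exp_add[symmetric] add_divide_distrib[symmetric] mult_ac add_ac)
  qed
  also have "\<dots> = exp (l * (a\<^sup>2 + (b x)\<^sup>2 + S)) * measure_pmf.expectation (p x) (\<lambda>y. exp ((2 * a * l) * f x y))"
    by simp
  also have "\<dots> \<le> exp (l * (a\<^sup>2 + (b x)\<^sup>2 + S)) * exp ((2 * a * l)\<^sup>2 * (b x)\<^sup>2 / 2)"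
    by (intro mult_left_mono Hoeffding_lemma_pmf fin) (use insert in auto)
  also have "\<dots> = exp (l * (1 + 2 * l * (b x)\<^sup>2) * a\<^sup>2 + l * ((b x)\<^sup>2 + S))"
    by (simp add: exp_add[symmetric] power2_eq_square algebra_simps)
  also have "\<dots> \<le> exp (1 / (t - 2 * S - 2 * (b x)\<^sup>2) * a\<^sup>2 + 1 / (t - 2 * S - 2 * (b x)\<^sup>2) * ((b x)\<^sup>2 + S))"
  proof -
    \<comment> \<open>With \<open>T = t - 2 * S\<close>, the coefficient of \<open>a^2\<close> is
      \<open>(T + 2 * (b x)^2) / T^2\<close>; the difference of squares bounds it by
      \<open>1 / (T - 2 * (b x)^2)\<close>.\<close>
    have "(t - 2 * S) * (t - 2 * S) \<ge> (t - 2 * S + 2 * (b x)\<^sup>2) * (t - 2 * S - 2 * (b x)\<^sup>2)"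
      using zero_le_square[of "(b x)\<^sup>2"] by (simp add: algebra_simps)
    hence "l * (1 + 2 * l * (b x)\<^sup>2) \<le> 1 / (t - 2 * S - 2 * (b x)\<^sup>2)"
      using t tS unfolding l_def by (simp add: divide_simps mult_ac) 
    moreover have "l \<le> 1 / (t - 2 * S - 2 * (b x)\<^sup>2)"
      unfolding l_def using t tS by (intro divide_left_mono) auto
    ultimately show ?thesis
      using S by (intro exp_mono add_mono mult_right_mono) auto
  qed
  also have "\<dots> = exp ((a\<^sup>2 + (\<Sum>j\<in>insert x J. (b j)\<^sup>2)) / (t - 2 * (\<Sum>j\<in>insert x J. (b j)\<^sup>2)))"
    using insert.hyps by (simp add: S_def add_divide_distrib diff_diff_eq add_ac distrib_left)
  finally show ?case .
qed simp

text \<open>The shift \<open>a\<close> collects the summands already split off in the induction; the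
  cross terms vanish because each summand is centred.\<close>

lemma expectation_square_sum_Pi_pmf:
  fixes f :: "'a \<Rightarrow> 'b \<Rightarrow> real"
  assumes "finite J"
    and "\<And>j. j \<in> J \<Longrightarrow> finite (set_pmf (p j))"
    and "\<And>j. j \<in> J \<Longrightarrow> measure_pmf.expectation (p j) (f j) = 0"
  shows "measure_pmf.expectation (Pi_pmf J dflt p) (\<lambda>w. (a + (\<Sum>j\<in>J. f j (w j)))\<^sup>2)
    = a\<^sup>2 + (\<Sum>j\<in>J. measure_pmf.expectation (p j) (\<lambda>y. (f j y)\<^sup>2))"
  using assms
proof (induction J arbitrary: a)
  case (insert x J)
  have fin: "finite (set_pmf (p x))" using insert by auto
  have *: "(\<Sum>j\<in>J. f j (if j = x then y else w j)) = (\<Sum>j\<in>J. f j (w j))" for y w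
    using insert.hyps by (intro sum.cong) auto
  define s where "s = (\<Sum>j\<in>J. measure_pmf.expectation (p j) (\<lambda>y. (f j y)\<^sup>2))"
  have "measure_pmf.expectation (Pi_pmf (insert x J) dflt p) (\<lambda>w. (a + (\<Sum>j\<in>insert x J. f j (w j)))\<^sup>2)
    = measure_pmf.expectation (p x) (\<lambda>y. measure_pmf.expectation (Pi_pmf J dflt p)
        (\<lambda>w. ((a + f x y) + (\<Sum>j\<in>J. f j (w j)))\<^sup>2))"
    using insert.hyps insert.prems by (subst expectation_Pi_pmf_insert) (auto simp: * add_ac)
  also have "\<dots> = measure_pmf.expectation (p x) (\<lambda>y. (a + f x y)\<^sup>2 + s)"
    unfolding s_def by (subst insert.IH) (use insert.prems in auto)
  also have "(\<lambda>y. (a + f x y)\<^sup>2 + s) = (\<lambda>y. (a\<^sup>2 + s) + 2 * a * f x y + (f x y)\<^sup>2)"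
    by (auto simp: power2_eq_square algebra_simps)
  also have "measure_pmf.expectation (p x) \<dots> = a\<^sup>2 + s + measure_pmf.expectation (p x) (\<lambda>y. (f x y)\<^sup>2)"
    using insert.prems(2)[of x] by (simp add: integrable_measure_pmf_finite fin)
  finally show ?case using insert.hyps by (simp add: s_def)
qed simp

text \<open>A discrete integration by parts. If \<open>Z\<close> is the sum over \<open>J\<close>,
  independent of the centred variable \<open>f x\<close>, then \<open>f x * h (Z + f x)\<close> and
  \<open>f x * (h (Z + f x) - h Z)\<close> have the same mean, and the latter is of second order in
  \<open>f x\<close>. This produces the variance of \<open>f x\<close> as a factor; \<open>K\<close>
  controls the increments of \<open>h\<close>.\<close>

lemma Stein_term_le:
  fixes f :: "'a \<Rightarrow> 'b \<Rightarrow> real"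
  assumes J: "finite J" "x \<notin> J"
    and fin: "\<And>j. j \<in> insert x J \<Longrightarrow> finite (set_pmf (p j))"
    and mean: "measure_pmf.expectation (p x) (f x) = 0"
    and h: "\<And>y z. y \<in> set_pmf (p x) \<Longrightarrow> \<bar>h (z + f x y) - h z\<bar> \<le> \<bar>f x y\<bar> * K z"
  shows "measure_pmf.expectation (Pi_pmf (insert x J) dflt p)
      (\<lambda>w. f x (w x) * h (\<Sum>j\<in>insert x J. f j (w j)))
    \<le> measure_pmf.expectation (p x) (\<lambda>y. (f x y)\<^sup>2) *
       measure_pmf.expectation (Pi_pmf J dflt p) (\<lambda>w. K (\<Sum>j\<in>J. f j (w j)))"
proof -
  have *: "(\<Sum>j\<in>J. f j (if j = x then y else w j)) = (\<Sum>j\<in>J. f j (w j))" for y w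
    using J by (intro sum.cong) auto
  have finx: "finite (set_pmf (p x))" using fin by auto
  have finJ: "finite (set_pmf (Pi_pmf J dflt p))" by (intro finite_set_Pi_pmf J fin) auto
  note int = integrable_measure_pmf_finite[OF finx] integrable_measure_pmf_finite[OF finJ]
  define Eh EK where "Eh = measure_pmf.expectation (Pi_pmf J dflt p) (\<lambda>w. h (\<Sum>j\<in>J. f j (w j)))"
    and "EK = measure_pmf.expectation (Pi_pmf J dflt p) (\<lambda>w. K (\<Sum>j\<in>J. f j (w j)))"
  have "measure_pmf.expectation (Pi_pmf (insert x J) dflt p)
      (\<lambda>w. f x (w x) * h (\<Sum>j\<in>insert x J. f j (w j)))
    = measure_pmf.expectation (p x) (\<lambda>y. measure_pmf.expectation (Pi_pmf J dflt p)
        (\<lambda>w. f x y * h ((\<Sum>j\<in>J. f j (w j)) + f x y)))"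
    using J fin by (subst expectation_Pi_pmf_insert) (auto simp: * add_ac)
  also have "\<dots> \<le> measure_pmf.expectation (p x) (\<lambda>y. measure_pmf.expectation (Pi_pmf J dflt p)
        (\<lambda>w. f x y * h (\<Sum>j\<in>J. f j (w j)) + (f x y)\<^sup>2 * K (\<Sum>j\<in>J. f j (w j))))"
  proof (intro integral_mono_AE int, unfold AE_measure_pmf_iff, intro ballI integral_mono int)
    fix y w assume y: "y \<in> set_pmf (p x)"
    define z where "z = (\<Sum>j\<in>J. f j (w j))"
    have "f x y * (h (z + f x y) - h z) \<le> \<bar>f x y\<bar> * \<bar>h (z + f x y) - h z\<bar>"
      by (simp add: abs_mult[symmetric])
    also have "\<dots> \<le> \<bar>f x y\<bar> * (\<bar>f x y\<bar> * K z)"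
      by (intro mult_left_mono h y) auto
    finally show "f x y * h (z + f x y) \<le> f x y * h z + (f x y)\<^sup>2 * K z"
      by (simp add: power2_eq_square algebra_simps)
  qed
  also have "\<dots> = measure_pmf.expectation (p x) (\<lambda>y. f x y * Eh + (f x y)\<^sup>2 * EK)"
    by (simp add: int Eh_def EK_def)
  also have "\<dots> = measure_pmf.expectation (p x) (\<lambda>y. (f x y)\<^sup>2) * EK"
    by (simp add: int mean)
  finally show ?thesis by (simp add: EK_def)
qed

text \<open>The kernel is chosen so that \<open>z * h z\<close> is
  \<open>z ^ 4 * exp (z^2 / 16)\<close>. By the mean value theorem it suffices to bound
  \<open>h'\<close> within distance \<open>1\<close> of \<open>z\<close>. With
  \<open>v = u^2 / 16\<close>, the polynomial factor costs \<open>112 * exp v\<close>, and moving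
  from \<open>u\<close> to \<open>z\<close> costs \<open>u^2 \<le> 2 * z^2 + 2\<close>; together the
  exponent grows from \<open>1 / 16\<close> to \<open>1 / 4\<close>, and
  \<open>112 * exp (1 / 4) \<le> 150\<close>.\<close>

lemma fourth_moment_kernel_Lipschitz:
  fixes y z :: real
  assumes y: "\<bar>y\<bar> \<le> 1"
  defines "h \<equiv> \<lambda>z::real. z ^ 3 * exp (z\<^sup>2 / 16)"
  shows "\<bar>h (z + y) - h z\<bar> \<le> \<bar>y\<bar> * (150 * exp (z\<^sup>2 / 4))"
proof -
  define h' where "h' = (\<lambda>z::real. (3 * z\<^sup>2 + z ^ 4 / 8) * exp (z\<^sup>2 / 16))"
  have der: "(h has_real_derivative h' u) (at u)" for u
    unfolding h_def h'_def
    by (auto intro!: derivative_eq_intros simp: power2_eq_square power3_eq_cube power4_eq_xxxx algebra_simps)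
  have bound: "norm (h' u) \<le> 150 * exp (z\<^sup>2 / 4)" if u: "u \<in> closed_segment z (z + y)" for u
  proof -
    define v where "v = u\<^sup>2 / 16"
    have v: "v \<ge> 0" "u\<^sup>2 = 16 * v" by (auto simp: v_def)
    have "u ^ 4 = (u\<^sup>2)\<^sup>2" by simp
    hence u4: "u ^ 4 = 256 * v\<^sup>2" using v by simp
    have ev: "v \<le> exp v" "v\<^sup>2 / 2 \<le> exp v"
      using exp_ge_add_one_self[of v] exp_lower_Taylor_quadratic[of v] v by linarith+
    have "\<bar>u - z\<bar> \<le> 1" using u y
      by (auto simp: closed_segment_eq_real_ivl split: if_splits)
    hence "(u - z)\<^sup>2 \<le> 1" by (simp add: abs_square_le_1)
    moreover have "0 \<le> (u - 2 * z)\<^sup>2" by simp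
    ultimately have "u\<^sup>2 \<le> 2 * z\<^sup>2 + 2"
      by (simp add: power2_eq_square algebra_simps)
    hence v2: "2 * v \<le> 1/4 + z\<^sup>2 / 4" by (simp add: v_def)
    have "norm (h' u) = (48 * v + 32 * v\<^sup>2) * exp v"
      using v by (simp add: h'_def u4 abs_mult)
    also have "\<dots> \<le> (112 * exp v) * exp v" using ev by (intro mult_right_mono) auto
    also have "\<dots> = 112 * exp (2 * v)" by (simp add: exp_add[symmetric])
    also have "\<dots> \<le> 112 * exp (1/4 + z\<^sup>2 / 4)" using v2 by simp
    also have "\<dots> = 112 * exp (1/4) * exp (z\<^sup>2/4)" by (simp add: exp_add)
    also have "exp (1/4) * 3 \<le> (4::real)"
      using exp_ge_add_one_self[of "-1/4::real"] by (simp add: exp_minus field_simps)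
    hence "112 * exp (1/4) * exp (z\<^sup>2/4) \<le> 150 * exp (z\<^sup>2/4)"
      by (intro mult_right_mono) auto
    finally show ?thesis .
  qed
  have "norm (h (z + y) - h z) \<le> 150 * exp (z\<^sup>2 / 4) * norm ((z + y) - z)"
    by (rule field_differentiable_bound[where f' = h' and S = "closed_segment z (z + y)"])
       (use der bound in \<open>auto intro: has_field_derivative_at_within simp del: closed_segment_eq_real_ivl\<close>)
  thus ?thesis by (simp add: mult_ac)
qed

lemma exp_half_le: "exp (1 / 2 :: real) \<le> 2"
  using exp_ge_add_one_self[of "-1/2::real"] by (simp add: exp_minus field_simps)

text \<open>The case \<open>t = 4\<close> of the previous moment bound, where the exponent
  \<open>S / (4 - 2 * S)\<close> is at most \<open>1 / 2\<close>. The scale \<open>1 / 4\<close> is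
  the one at which \<open>fourth_moment_kernel_Lipschitz\<close> ends.\<close>

lemma expectation_exp_quarter_square_le:
  fixes f :: "'a \<Rightarrow> 'b \<Rightarrow> real"
  assumes "finite J"
    and "\<And>j. j \<in> J \<Longrightarrow> finite (set_pmf (p j))"
    and "\<And>j. j \<in> J \<Longrightarrow> measure_pmf.expectation (p j) (f j) = 0"
    and "\<And>j y. j \<in> J \<Longrightarrow> y \<in> set_pmf (p j) \<Longrightarrow> \<bar>f j y\<bar> \<le> b j"
    and S: "(\<Sum>j\<in>J. (b j)\<^sup>2) \<le> 1"
  shows "measure_pmf.expectation (Pi_pmf J dflt p) (\<lambda>w. exp ((\<Sum>j\<in>J. f j (w j))\<^sup>2 / 4)) \<le> 2"
proof -
  define S where "S = (\<Sum>j\<in>J. (b j)\<^sup>2)"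
  have S01: "0 \<le> S" "S \<le> 1" using S by (auto simp: S_def sum_nonneg)
  have "measure_pmf.expectation (Pi_pmf J dflt p) (\<lambda>w. exp ((0 + (\<Sum>j\<in>J. f j (w j)))\<^sup>2 / 4))
      \<le> exp ((0\<^sup>2 + S) / (4 - 2 * S))"
    unfolding S_def by (rule expectation_exp_square_le) (use assms in auto)
  also have "\<dots> \<le> exp (1 / 2)" using S01 by (simp add: field_simps)
  also have "\<dots> \<le> 2" by (rule exp_half_le)
  finally show ?thesis by simp
qed

text \<open>The bound is linear in the variance although the tails are only controlled by the \<open>b j\<close>;
  this comes from integrating by parts in each summand separately.\<close>
lemma expectation_fourth_exp_le:
  fixes f :: "'a \<Rightarrow> 'b \<Rightarrow> real"
  assumes J: "finite J"
    and fin: "\<And>j. j \<in> J \<Longrightarrow> finite (set_pmf (p j))"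
    and mean: "\<And>j. j \<in> J \<Longrightarrow> measure_pmf.expectation (p j) (f j) = 0"
    and b: "\<And>j y. j \<in> J \<Longrightarrow> y \<in> set_pmf (p j) \<Longrightarrow> \<bar>f j y\<bar> \<le> b j"
    and S: "(\<Sum>j\<in>J. (b j)\<^sup>2) \<le> 1"
  shows "measure_pmf.expectation (Pi_pmf J dflt p)
      (\<lambda>w. (\<Sum>j\<in>J. f j (w j)) ^ 4 * exp ((\<Sum>j\<in>J. f j (w j))\<^sup>2 / 16))
    \<le> 300 * (\<Sum>j\<in>J. measure_pmf.expectation (p j) (\<lambda>y. (f j y)\<^sup>2))"
proof -
  define h where "h = (\<lambda>z::real. z ^ 3 * exp (z\<^sup>2 / 16))"
  have finJ: "finite (set_pmf (Pi_pmf J dflt p))" by (intro finite_set_Pi_pmf J fin)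
  have summand: "measure_pmf.expectation (Pi_pmf J dflt p) (\<lambda>w. f x (w x) * h (\<Sum>j\<in>J. f j (w j)))
      \<le> measure_pmf.expectation (p x) (\<lambda>y. (f x y)\<^sup>2) * 300" if x: "x \<in> J" for x
  proof -
    have Jx: "insert x (J - {x}) = J" using x by auto
    have Sx: "(\<Sum>j\<in>J - {x}. (b j)\<^sup>2) \<le> 1"
      using S sum_mono2[of J "J - {x}" "\<lambda>j. (b j)\<^sup>2"] J by force
    have b1: "\<bar>f x y\<bar> \<le> 1" if "y \<in> set_pmf (p x)" for y
    proof -
      have "(b x)\<^sup>2 \<le> 1" using S member_le_sum[OF x, of "\<lambda>j. (b j)\<^sup>2"] J by force
      hence "\<bar>b x\<bar> \<le> 1" by (simp add: abs_square_le_1)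
      thus ?thesis using b[OF x that] by linarith
    qed
    have "measure_pmf.expectation (Pi_pmf (insert x (J - {x})) dflt p)
        (\<lambda>w. f x (w x) * h (\<Sum>j\<in>insert x (J - {x}). f j (w j)))
      \<le> measure_pmf.expectation (p x) (\<lambda>y. (f x y)\<^sup>2) *
         measure_pmf.expectation (Pi_pmf (J - {x}) dflt p)
           (\<lambda>w. 150 * exp ((\<Sum>j\<in>J - {x}. f j (w j))\<^sup>2 / 4))"
      unfolding h_def
      by (intro Stein_term_le fourth_moment_kernel_Lipschitz)
         (use J fin mean x b1 in auto)
    also have "\<dots> \<le> measure_pmf.expectation (p x) (\<lambda>y. (f x y)\<^sup>2) * (150 * 2)"
    proof (intro mult_left_mono)
      show "measure_pmf.expectation (Pi_pmf (J - {x}) dflt p)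
           (\<lambda>w. 150 * exp ((\<Sum>j\<in>J - {x}. f j (w j))\<^sup>2 / 4)) \<le> 150 * 2"
        using expectation_exp_quarter_square_le[of "J - {x}" p f b dflt] J fin mean b Sx by simp
    qed simp
    finally show ?thesis unfolding Jx by simp
  qed
  \<comment> \<open>One of the four factors is expanded as the sum over \<open>x\<close>; the other
    three and the exponential form \<open>h\<close> of the whole sum, which is the shape treated by
    \<open>Stein_term_le\<close>.\<close>
  have "(\<Sum>j\<in>J. f j (w j)) ^ 4 * exp ((\<Sum>j\<in>J. f j (w j))\<^sup>2 / 16)
    = (\<Sum>x\<in>J. f x (w x) * h (\<Sum>j\<in>J. f j (w j)))" for w
    by (simp add: h_def sum_distrib_right[symmetric] power4_eq_xxxx power3_eq_cube)
  hence "measure_pmf.expectation (Pi_pmf J dflt p)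
      (\<lambda>w. (\<Sum>j\<in>J. f j (w j)) ^ 4 * exp ((\<Sum>j\<in>J. f j (w j))\<^sup>2 / 16))
    = (\<Sum>x\<in>J. measure_pmf.expectation (Pi_pmf J dflt p) (\<lambda>w. f x (w x) * h (\<Sum>j\<in>J. f j (w j))))"
    by (simp add: integrable_measure_pmf_finite finJ)
  also have "\<dots> \<le> (\<Sum>x\<in>J. measure_pmf.expectation (p x) (\<lambda>y. (f x y)\<^sup>2) * 300)"
    by (intro sum_mono summand)
  finally show ?thesis by (simp add: sum_distrib_left mult_ac)
qed

lemma exp_le_quadratic:
  fixes x :: real
  shows "exp x \<le> 1 + x + x\<^sup>2 / 2 * exp \<bar>x\<bar>"
proof -
  obtain t where t: "\<bar>t\<bar> \<le> \<bar>x\<bar>" "exp x = (\<Sum>m<2. x ^ m / fact m) + exp t / fact 2 * x ^ 2"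
    using Maclaurin_exp_le[of x 2] by blast
  have "exp t * (x\<^sup>2 / 2) \<le> exp \<bar>x\<bar> * (x\<^sup>2 / 2)"
    using t(1) by (intro mult_right_mono) auto
  thus ?thesis using t(2) by (simp add: eval_nat_numeral mult_ac)
qed

text \<open>Taylor expansion to second order: the linear term has mean exactly \<open>l * s\<close>,
  and for \<open>l\<close> of absolute value at most \<open>1 / 16\<close> the remainder is
  dominated by the fourth moment kernel, hence by \<open>l^2 / 2 * (300 * s)\<close>. So the
  logarithmic moment of the centred square is at most \<open>150 * l^2 * s\<close>, linear in the
  variance \<open>s\<close>. Both signs of \<open>l\<close> are covered, for the two tails.\<close>

lemma expectation_exp_centered_square_le:
  fixes f :: "'a \<Rightarrow> 'b \<Rightarrow> real"
  assumes J: "finite J"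
    and fin: "\<And>j. j \<in> J \<Longrightarrow> finite (set_pmf (p j))"
    and mean: "\<And>j. j \<in> J \<Longrightarrow> measure_pmf.expectation (p j) (f j) = 0"
    and b: "\<And>j y. j \<in> J \<Longrightarrow> y \<in> set_pmf (p j) \<Longrightarrow> \<bar>f j y\<bar> \<le> b j"
    and S: "(\<Sum>j\<in>J. (b j)\<^sup>2) \<le> 1"
    and l: "\<bar>l\<bar> \<le> 1 / 16"
  defines "s \<equiv> \<Sum>j\<in>J. measure_pmf.expectation (p j) (\<lambda>y. (f j y)\<^sup>2)"
  shows "measure_pmf.expectation (Pi_pmf J dflt p) (\<lambda>w. exp (l * (\<Sum>j\<in>J. f j (w j))\<^sup>2))
    \<le> exp (l * s + 150 * l\<^sup>2 * s)"
proof -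
  have finJ: "finite (set_pmf (Pi_pmf J dflt p))" by (intro finite_set_Pi_pmf J fin)
  note int = integrable_measure_pmf_finite[OF finJ]
  define Z where "Z = (\<lambda>w. \<Sum>j\<in>J. f j (w j))"
  have pt: "exp (l * (Z w)\<^sup>2) \<le> 1 + l * (Z w)\<^sup>2 + l\<^sup>2 / 2 * (Z w ^ 4 * exp ((Z w)\<^sup>2 / 16))" for w
  proof -
    have "\<bar>l * (Z w)\<^sup>2\<bar> \<le> 1 / 16 * (Z w)\<^sup>2"
      unfolding abs_mult using l by (intro mult_mono) auto
    hence "l\<^sup>2 / 2 * Z w ^ 4 * exp \<bar>l * (Z w)\<^sup>2\<bar> \<le> l\<^sup>2 / 2 * Z w ^ 4 * exp ((Z w)\<^sup>2 / 16)"
      by (intro mult_left_mono) auto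
    moreover have "(l * (Z w)\<^sup>2)\<^sup>2 = l\<^sup>2 * Z w ^ 4" by (simp add: power_mult_distrib)
    ultimately show ?thesis using exp_le_quadratic[of "l * (Z w)\<^sup>2"] by simp
  qed
  have "measure_pmf.expectation (Pi_pmf J dflt p) (\<lambda>w. exp (l * (Z w)\<^sup>2))
     \<le> measure_pmf.expectation (Pi_pmf J dflt p)
        (\<lambda>w. 1 + l * (Z w)\<^sup>2 + l\<^sup>2 / 2 * (Z w ^ 4 * exp ((Z w)\<^sup>2 / 16)))"
    by (intro integral_mono int pt)
  also have "\<dots> = 1 + l * measure_pmf.expectation (Pi_pmf J dflt p) (\<lambda>w. (0 + Z w)\<^sup>2) +
      l\<^sup>2 / 2 * measure_pmf.expectation (Pi_pmf J dflt p) (\<lambda>w. Z w ^ 4 * exp ((Z w)\<^sup>2 / 16))"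
    by (simp add: int)
  also have "\<dots> \<le> 1 + l * s + l\<^sup>2 / 2 * (300 * s)"
  proof -
    have "measure_pmf.expectation (Pi_pmf J dflt p) (\<lambda>w. (0 + Z w)\<^sup>2) = s"
      unfolding Z_def s_def by (rule trans[OF expectation_square_sum_Pi_pmf[OF J fin mean]]) auto
    moreover have "measure_pmf.expectation (Pi_pmf J dflt p) (\<lambda>w. Z w ^ 4 * exp ((Z w)\<^sup>2 / 16)) \<le> 300 * s"
      unfolding Z_def s_def by (rule expectation_fourth_exp_le[OF J fin mean b S])
    ultimately show ?thesis using mult_left_mono[of _ "300 * s" "l\<^sup>2 / 2"] by simp
  qed
  also have "\<dots> \<le> exp (l * s + 150 * l\<^sup>2 * s)"
    using exp_ge_add_one_self[of "l * s + 150 * l\<^sup>2 * s"] by (simp add: algebra_simps)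
  finally show ?thesis by (simp add: Z_def)
qed

section \<open>Tail bounds for one fixed vector\<close>

lemma prob_ge_le_expectation_exp:
  fixes X :: "'a \<Rightarrow> real"
  assumes "finite (set_pmf M)"
    and "\<And>w. w \<in> E \<Longrightarrow> 0 \<le> X w"
  shows "measure_pmf.prob M E \<le> measure_pmf.expectation M (\<lambda>w. exp (X w))"
proof -
  have "measure_pmf.prob M E = measure_pmf.expectation M (indicator E)" by simp
  also have "\<dots> \<le> measure_pmf.expectation M (\<lambda>w. exp (X w))"
    using assms by (intro integral_mono integrable_measure_pmf_finite) (auto simp: indicator_def)
  finally show ?thesis .
qed

lemma prob_abs_sum_ge_le:
  fixes f :: "'a \<Rightarrow> 'b \<Rightarrow> real"
  assumes J: "finite J"
    and fin: "\<And>j. j \<in> J \<Longrightarrow> finite (set_pmf (p j))"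
    and mean: "\<And>j. j \<in> J \<Longrightarrow> measure_pmf.expectation (p j) (f j) = 0"
    and b: "\<And>j y. j \<in> J \<Longrightarrow> y \<in> set_pmf (p j) \<Longrightarrow> \<bar>f j y\<bar> \<le> b j"
    and S: "(\<Sum>j\<in>J. (b j)\<^sup>2) \<le> 1"
    and t: "t \<ge> 0"
  shows "measure_pmf.prob (Pi_pmf J dflt p) {w. \<bar>\<Sum>j\<in>J. f j (w j)\<bar> \<ge> 2 * sqrt t} \<le> 2 * exp (- t)"
proof -
  have finJ: "finite (set_pmf (Pi_pmf J dflt p))" by (intro finite_set_Pi_pmf J fin)
  have "measure_pmf.prob (Pi_pmf J dflt p) {w. \<bar>\<Sum>j\<in>J. f j (w j)\<bar> \<ge> 2 * sqrt t}
    \<le> measure_pmf.expectation (Pi_pmf J dflt p) (\<lambda>w. exp ((\<Sum>j\<in>J. f j (w j))\<^sup>2 / 4 - t))"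
  proof (rule prob_ge_le_expectation_exp[OF finJ])
    fix w assume "w \<in> {w. \<bar>\<Sum>j\<in>J. f j (w j)\<bar> \<ge> 2 * sqrt t}"
    hence "(2 * sqrt t)\<^sup>2 \<le> \<bar>\<Sum>j\<in>J. f j (w j)\<bar>\<^sup>2" using t by (intro power_mono) auto
    thus "0 \<le> (\<Sum>j\<in>J. f j (w j))\<^sup>2 / 4 - t" using t by (simp add: power_mult_distrib)
  qed
  also have "\<dots> = measure_pmf.expectation (Pi_pmf J dflt p) (\<lambda>w. exp ((\<Sum>j\<in>J. f j (w j))\<^sup>2 / 4)) * exp (- t)"
    unfolding diff_conv_add_uminus exp_add by simp
  also have "\<dots> \<le> 2 * exp (- t)"
    by (intro mult_right_mono expectation_exp_quarter_square_le[OF J fin mean b S]) auto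
  finally show ?thesis .
qed

text \<open>Chernoff's method: by row independence the logarithmic moments of the centred squares
  add up to at most \<open>150 * l^2 * s\<close>, leaving the exponent
  \<open>150 * l^2 * s - l * \<tau>\<close> for both tails. The bounds \<open>b j\<close> are shared
  by all rows since they will be the coordinates of the fixed vector.\<close>

lemma prob_sum_squares_deviation_le:
  fixes f :: "'i \<times> 'j \<Rightarrow> 'b \<Rightarrow> real"
  assumes I: "finite I" and J: "finite J"
    and fin: "\<And>ij. ij \<in> I \<times> J \<Longrightarrow> finite (set_pmf (p ij))"
    and mean: "\<And>ij. ij \<in> I \<times> J \<Longrightarrow> measure_pmf.expectation (p ij) (f ij) = 0"
    and b: "\<And>i j y. i \<in> I \<Longrightarrow> j \<in> J \<Longrightarrow> y \<in> set_pmf (p (i, j)) \<Longrightarrow> \<bar>f (i, j) y\<bar> \<le> b j"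
    and S: "(\<Sum>j\<in>J. (b j)\<^sup>2) \<le> 1"
    and t: "t > 0"
  defines "s \<equiv> \<Sum>i\<in>I. \<Sum>j\<in>J. measure_pmf.expectation (p (i, j)) (\<lambda>y. (f (i, j) y)\<^sup>2)"
  assumes N: "s \<le> N"
  shows "measure_pmf.prob (Pi_pmf (I \<times> J) dflt p)
      {w. \<bar>(\<Sum>i\<in>I. (\<Sum>j\<in>J. f (i, j) (w (i, j)))\<^sup>2) - s\<bar> \<ge> 2416 * (sqrt (N * t) + t)}
    \<le> 2 * exp (- t)"
proof -
  define X where "X = (\<lambda>w. \<Sum>i\<in>I. (\<Sum>j\<in>J. f (i, j) (w (i, j)))\<^sup>2)"
  define P where "P = Pi_pmf (I \<times> J) dflt p"
  define \<tau> where "\<tau> = 2416 * (sqrt (N * t) + t)"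
  have finP: "finite (set_pmf P)" unfolding P_def by (intro finite_set_Pi_pmf fin) (use I J in auto)
  have s0: "s \<ge> 0" unfolding s_def by (intro sum_nonneg Bochner_Integration.integral_nonneg) auto
  have mgf: "measure_pmf.expectation P (\<lambda>w. exp (l * X w)) \<le> exp (l * s + 150 * l\<^sup>2 * s)"
    if l: "\<bar>l\<bar> \<le> 1 / 16" for l
  proof -
    have reindex: "(\<Sum>ij\<in>{i} \<times> J. g ij) = (\<Sum>j\<in>J. g (i, j))" for g :: "'i \<times> 'j \<Rightarrow> real" and i
      using sum.cartesian_product[of "\<lambda>i j. g (i, j)" J "{i}"] by simp
    have "measure_pmf.expectation P (\<lambda>w. exp (l * X w))
       = measure_pmf.expectation P (\<lambda>w. \<Prod>i\<in>I. exp (l * (\<Sum>j\<in>J. f (i, j) (w (i, j)))\<^sup>2))"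
      unfolding X_def by (simp add: exp_sum[OF I, symmetric] sum_distrib_left)
    also have "\<dots> = (\<Prod>i\<in>I. measure_pmf.expectation (Pi_pmf ({i} \<times> J) dflt p)
        (\<lambda>w. exp (l * (\<Sum>j\<in>J. f (i, j) (w (i, j)))\<^sup>2)))"
      unfolding P_def by (intro expectation_prod_blocks I J fin) auto
    also have "\<dots> \<le> (\<Prod>i\<in>I. exp (l * (\<Sum>j\<in>J. measure_pmf.expectation (p (i, j)) (\<lambda>y. (f (i, j) y)\<^sup>2))
        + 150 * l\<^sup>2 * (\<Sum>j\<in>J. measure_pmf.expectation (p (i, j)) (\<lambda>y. (f (i, j) y)\<^sup>2))))"
    proof (intro prod_mono conjI Bochner_Integration.integral_nonneg)
      fix i assume i: "i \<in> I"
      show "measure_pmf.expectation (Pi_pmf ({i} \<times> J) dflt p) (\<lambda>w. exp (l * (\<Sum>j\<in>J. f (i, j) (w (i, j)))\<^sup>2))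
        \<le> exp (l * (\<Sum>j\<in>J. measure_pmf.expectation (p (i, j)) (\<lambda>y. (f (i, j) y)\<^sup>2))
        + 150 * l\<^sup>2 * (\<Sum>j\<in>J. measure_pmf.expectation (p (i, j)) (\<lambda>y. (f (i, j) y)\<^sup>2)))"
        using expectation_exp_centered_square_le[of "{i} \<times> J" p f "\<lambda>ij. b (snd ij)" l dflt]
          i J fin mean b S l by (auto simp: reindex)
    qed auto
    also have "\<dots> = exp (l * s + 150 * l\<^sup>2 * s)"
      unfolding s_def by (simp add: exp_sum[OF I, symmetric] sum_distrib_left sum.distrib)
    finally show ?thesis .
  qed
  have tail: "measure_pmf.prob P {w. \<bar>X w - s\<bar> \<ge> \<tau>} \<le> 2 * exp (150 * l\<^sup>2 * s - l * \<tau>)"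
    if l: "0 \<le> l" "l \<le> 1 / 16" for l
  proof -
    have "measure_pmf.prob P {w. \<bar>X w - s\<bar> \<ge> \<tau>} \<le>
        measure_pmf.prob P ({w. X w - s \<ge> \<tau>} \<union> {w. s - X w \<ge> \<tau>})"
      by (intro measure_pmf.finite_measure_mono) auto
    also have "\<dots> \<le> measure_pmf.prob P {w. X w - s \<ge> \<tau>} + measure_pmf.prob P {w. s - X w \<ge> \<tau>}"
      by (intro measure_subadditive) (auto simp: measure_pmf.emeasure_eq_measure)
    also have "\<dots> \<le> measure_pmf.expectation P (\<lambda>w. exp (l * X w + (- l * s - l * \<tau>))) +
        measure_pmf.expectation P (\<lambda>w. exp (- l * X w + (l * s - l * \<tau>)))"
    proof (intro add_mono prob_ge_le_expectation_exp finP)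
      fix w assume "w \<in> {w. X w - s \<ge> \<tau>}"
      hence "l * (X w - s - \<tau>) \<ge> 0" using l by auto
      thus "0 \<le> l * X w + (- l * s - l * \<tau>)" by (simp add: algebra_simps)
    next
      fix w assume "w \<in> {w. s - X w \<ge> \<tau>}"
      hence "l * (s - X w - \<tau>) \<ge> 0" using l by auto
      thus "0 \<le> - l * X w + (l * s - l * \<tau>)" by (simp add: algebra_simps)
    qed
    also have "\<dots> = measure_pmf.expectation P (\<lambda>w. exp (l * X w)) * exp (- l * s - l * \<tau>)
        + measure_pmf.expectation P (\<lambda>w. exp (- l * X w)) * exp (l * s - l * \<tau>)"
      unfolding exp_add by simp
    also have "\<dots> \<le> exp (l * s + 150 * l\<^sup>2 * s) * exp (- l * s - l * \<tau>)
        + exp (- l * s + 150 * (- l)\<^sup>2 * s) * exp (l * s - l * \<tau>)"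
      by (intro add_mono mult_right_mono mgf) (use l in auto)
    also have "\<dots> = 2 * exp (150 * l\<^sup>2 * s - l * \<tau>)"
      by (simp add: exp_add[symmetric])
    finally show ?thesis .
  qed
  have N0: "N \<ge> 0" using s0 N by simp
  \<comment> \<open>The choice \<open>l = sqrt t / sqrt N\<close> balances the two terms. If it
    exceeds \<open>1 / 16\<close>, the endpoint is taken: then \<open>N < 256 * t\<close>, the
    quadratic term is at most \<open>150 * t\<close>, and \<open>2416 = 16 * 151\<close> makes
    \<open>l * \<tau>\<close> at least \<open>151 * t\<close>.\<close>
  have "\<exists>l. 0 \<le> l \<and> l \<le> 1 / 16 \<and> 150 * l\<^sup>2 * s - l * \<tau> \<le> - t"
  proof (cases "16 * sqrt t \<le> sqrt N")
    case True
    have sN: "sqrt N > 0" using True t by (smt (verit) real_sqrt_gt_zero)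
    define l where "l = sqrt t / sqrt N"
    have l0: "l \<ge> 0" using t N0 by (simp add: l_def)
    have l16: "l \<le> 1 / 16" using True sN by (simp add: l_def field_simps)
    have "150 * l\<^sup>2 * s \<le> 150 * (l\<^sup>2 * N)"
      using mult_left_mono[OF N, of "150 * l\<^sup>2"] by simp
    also have "l\<^sup>2 * N = t" using sN t N0 by (simp add: l_def power_divide)
    finally have "150 * l\<^sup>2 * s \<le> 150 * t" .
    moreover have "l * \<tau> = 2416 * t + l * (2416 * t)"
      using sN t N0 by (simp add: l_def \<tau>_def real_sqrt_mult field_simps)
    moreover have "l * (2416 * t) \<ge> 0" using l0 t by simp
    ultimately have "150 * l\<^sup>2 * s - l * \<tau> \<le> - t" using t by linarith
    thus ?thesis using l0 l16 by blast
  next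
    case False
    hence "sqrt N < 16 * sqrt t" by simp
    hence "(sqrt N)\<^sup>2 \<le> (16 * sqrt t)\<^sup>2" using N0 by (intro power_mono) auto
    hence "N \<le> 256 * t" using N0 t by (simp add: power_mult_distrib)
    moreover have "\<tau> \<ge> 2416 * t" using N0 t by (simp add: \<tau>_def)
    ultimately show ?thesis using N by (intro exI[of _ "1/16"]) (auto simp: power2_eq_square)
  qed
  then obtain l where l: "0 \<le> l" "l \<le> 1 / 16" "150 * l\<^sup>2 * s - l * \<tau> \<le> - t" by auto
  have "2 * exp (150 * l\<^sup>2 * s - l * \<tau>) \<le> 2 * exp (- t)" using l(3) by simp
  hence "measure_pmf.prob P {w. \<bar>X w - s\<bar> \<ge> \<tau>} \<le> 2 * exp (- t)"
    using tail[OF l(1,2)] by linarith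
  thus ?thesis by (simp add: X_def P_def \<tau>_def)
qed

subsection \<open>Nets and quadratic forms\<close>

lemma abs_le_square_int: "\<bar>k\<bar> \<le> (k::int)\<^sup>2"
proof (cases "k = 0")
  case False
  hence "\<bar>k\<bar> * 1 \<le> \<bar>k\<bar> * \<bar>k\<bar>" by (intro mult_left_mono) auto
  thus ?thesis by (simp add: power2_eq_square)
qed simp

lemma sum_half_power_abs:
  "(\<Sum>k = - int K..int K. (1 / 2 :: real) ^ nat \<bar>k\<bar>) = 3 - 2 * (1 / 2) ^ K"
proof (induction K)
  case (Suc K)
  have "{- int (Suc K)..int (Suc K)} = insert (- int (Suc K)) (insert (int (Suc K)) {- int K..int K})"
    by auto
  thus ?case using Suc by (simp add: nat_add_distrib)
qed simp

text \<open>Counting by exponential weights: each counted point has weight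
  \<open>exp (M - \<Sum>i\<in>I. (k i)^2) \<ge> 1\<close>, and the sum of the weights over the box
  factorises into one-dimensional sums, each below a two-sided geometric series with value less than
  \<open>3\<close>. The box size \<open>K\<close> serves only finiteness and does not enter the
  bound.\<close>

lemma card_small_integer_points_le:
  fixes I :: "'a set" and M :: real
  assumes I: "finite I"
  shows "real (card {k \<in> I \<rightarrow>\<^sub>E {- int K..int K}. (\<Sum>i\<in>I. (real_of_int (k i))\<^sup>2) \<le> M})
    \<le> exp M * 3 ^ card I"
proof -
  define F where "F = I \<rightarrow>\<^sub>E {- int K..int K}"
  have F: "finite F" using I by (auto simp: F_def intro!: finite_PiE)
  have exp_sq: "exp (- (real_of_int k)\<^sup>2) \<le> (1 / 2) ^ nat \<bar>k\<bar>" for k :: int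
  proof -
    have "\<bar>k\<bar> \<le> k\<^sup>2" by (rule abs_le_square_int)
    hence "real_of_int \<bar>k\<bar> \<le> real_of_int (k\<^sup>2)" by (simp only: of_int_le_iff)
    hence "real (nat \<bar>k\<bar>) \<le> (real_of_int k)\<^sup>2" by simp
    hence "exp (- (real_of_int k)\<^sup>2) \<le> exp (- 1) ^ nat \<bar>k\<bar>"
      by (simp add: exp_of_nat_mult[symmetric])
    also have "\<dots> \<le> (1 / 2) ^ nat \<bar>k\<bar>"
      using exp_ge_add_one_self[of "1::real"] by (intro power_mono) (auto simp: exp_minus field_simps)
    finally show ?thesis .
  qed
  have "real (card {k \<in> F. (\<Sum>i\<in>I. (real_of_int (k i))\<^sup>2) \<le> M})
      = (\<Sum>k\<in>{k \<in> F. (\<Sum>i\<in>I. (real_of_int (k i))\<^sup>2) \<le> M}. 1)" by simp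
  also have "\<dots> \<le> (\<Sum>k\<in>{k \<in> F. (\<Sum>i\<in>I. (real_of_int (k i))\<^sup>2) \<le> M}.
      exp M * (\<Prod>i\<in>I. exp (- (real_of_int (k i))\<^sup>2)))"
    by (intro sum_mono) (auto simp: exp_sum[OF I, symmetric] exp_add[symmetric] sum_negf)
  also have "\<dots> \<le> (\<Sum>k\<in>F. exp M * (\<Prod>i\<in>I. exp (- (real_of_int (k i))\<^sup>2)))"
    using F by (intro sum_mono2) (auto intro!: mult_nonneg_nonneg prod_nonneg)
  also have "\<dots> = exp M * (\<Prod>i\<in>I. \<Sum>k = - int K..int K. exp (- (real_of_int k)\<^sup>2))"
    unfolding F_def sum_distrib_left[symmetric] by (subst prod_sum_PiE[OF I]) auto
  also have "\<dots> \<le> exp M * (\<Prod>i\<in>I. 3)"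
  proof (intro mult_left_mono prod_mono conjI sum_nonneg)
    have "(\<Sum>k = - int K..int K. exp (- (real_of_int k)\<^sup>2)) \<le> (\<Sum>k = - int K..int K. (1 / 2) ^ nat \<bar>k\<bar>)"
      by (intro sum_mono exp_sq)
    also have "\<dots> \<le> 3" unfolding sum_half_power_abs by simp
    finally show "(\<Sum>k = - int K..int K. exp (- (real_of_int k)\<^sup>2)) \<le> 3" .
  qed auto
  finally show ?thesis by (simp add: F_def)
qed

text \<open>The net consists of the points of a scaled integer lattice; rounding towards zero keeps the
  approximating point inside the ball.\<close>
lemma unit_ball_net:
  assumes m: "m \<ge> 1"
  obtains T :: "(nat \<Rightarrow> real) set"
  where "finite T" "real (card T) \<le> exp (66 * real m)"
    "\<And>y. y \<in> T \<Longrightarrow> (\<Sum>i<m. (y i)\<^sup>2) \<le> 1"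
    "\<And>x. (\<Sum>i<m. (x i)\<^sup>2) \<le> 1 \<Longrightarrow> \<exists>y\<in>T. (\<Sum>i<m. (x i - y i)\<^sup>2) \<le> 1 / 64"
proof -
  \<comment> \<open>The lattice has mesh \<open>1 / s\<close>, so rounding every coordinate costs at
    most \<open>m / s^2 = 1 / 64\<close> in squared norm.\<close>
  define s where "s = 8 * sqrt (real m)"
  have s: "s > 0" "s\<^sup>2 = 64 * real m" using m by (auto simp: s_def power_mult_distrib)
  \<comment> \<open>The box cuts off no lattice point of the ball, since an integer is bounded in
    absolute value by its square, here at most \<open>64 * m\<close>.\<close>
  define F where "F = {k \<in> {..<m} \<rightarrow>\<^sub>E {- int (64 * m)..int (64 * m)}.
      (\<Sum>i<m. (real_of_int (k i))\<^sup>2) \<le> 64 * real m}"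
  define T where "T = (\<lambda>k i. real_of_int (k i) / s) ` F"
  have "finite F"
    unfolding F_def by (rule finite_subset[of _ "{..<m} \<rightarrow>\<^sub>E {- int (64 * m)..int (64 * m)}"])
      (auto intro!: finite_PiE)
  hence "finite T" by (simp add: T_def)
  moreover have "real (card T) \<le> exp (66 * real m)"
  proof -
    have "real (card T) \<le> real (card F)" using \<open>finite F\<close> by (simp add: T_def card_image_le)
    also have "\<dots> \<le> exp (64 * real m) * 3 ^ m"
      using card_small_integer_points_le[of "{..<m}" "64 * m" "64 * real m"] by (simp add: F_def)
    also have "(3::real) ^ m \<le> exp 2 ^ m"
      using exp_ge_add_one_self[of "2::real"] by (intro power_mono) auto
    also have "exp (64 * real m) * exp 2 ^ m = exp (66 * real m)"
      by (simp add: exp_of_nat_mult[symmetric] exp_add[symmetric] algebra_simps)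
    finally show ?thesis by simp
  qed
  moreover have "(\<Sum>i<m. (y i)\<^sup>2) \<le> 1" if "y \<in> T" for y
  proof -
    obtain k where k: "k \<in> F" "y = (\<lambda>i. real_of_int (k i) / s)" using \<open>y \<in> T\<close> unfolding T_def by blast
    have "(\<Sum>i<m. (y i)\<^sup>2) = (\<Sum>i<m. (real_of_int (k i))\<^sup>2) / s\<^sup>2"
      by (simp add: k(2) power_divide sum_divide_distrib)
    also have "\<dots> \<le> 1" using k(1) s m by (simp add: F_def)
    finally show ?thesis .
  qed
  moreover have "\<exists>y\<in>T. (\<Sum>i<m. (x i - y i)\<^sup>2) \<le> 1 / 64" if x: "(\<Sum>i<m. (x i)\<^sup>2) \<le> 1" for x
  proof -
    define k where "k = restrict (\<lambda>i. if x i \<ge> 0 then \<lfloor>s * x i\<rfloor> else \<lceil>s * x i\<rceil>) {..<m}"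
    have k1: "\<bar>real_of_int (k i)\<bar> \<le> \<bar>s * x i\<bar>" "\<bar>s * x i - real_of_int (k i)\<bar> \<le> 1" if i: "i < m" for i
    proof -
      show "\<bar>s * x i - real_of_int (k i)\<bar> \<le> 1" using i by (auto simp: k_def) linarith+
      show "\<bar>real_of_int (k i)\<bar> \<le> \<bar>s * x i\<bar>"
      proof (cases "x i \<ge> 0")
        case True
        hence "s * x i \<ge> 0" using s by simp
        thus ?thesis using i True by (auto simp: k_def)
      next
        case False
        hence "s * x i \<le> 0" using s by (simp add: mult_nonneg_nonpos)
        hence "\<lceil>s * x i\<rceil> \<le> 0" by simp
        hence "real_of_int \<lceil>s * x i\<rceil> \<le> 0" by simp
        thus ?thesis using i False \<open>s * x i \<le> 0\<close> le_of_int_ceiling[of "s * x i"] by (simp add: k_def)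
      qed
    qed
    have "(\<Sum>i<m. (real_of_int (k i))\<^sup>2) \<le> (\<Sum>i<m. s\<^sup>2 * (x i)\<^sup>2)"
    proof (intro sum_mono)
      fix i assume "i \<in> {..<m}"
      hence "(real_of_int (k i))\<^sup>2 \<le> (s * x i)\<^sup>2" using k1(1)[of i] by (simp only: abs_le_square_iff) auto
      thus "(real_of_int (k i))\<^sup>2 \<le> s\<^sup>2 * (x i)\<^sup>2" by (simp add: power_mult_distrib)
    qed
    also have "\<dots> \<le> s\<^sup>2 * 1" unfolding sum_distrib_left[symmetric] by (intro mult_left_mono x) auto
    finally have ks: "(\<Sum>i<m. (real_of_int (k i))\<^sup>2) \<le> 64 * real m" by (simp add: s)
    have "k i \<in> {- int (64 * m)..int (64 * m)}" if "i < m" for i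
    proof -
      have "(real_of_int (k i))\<^sup>2 \<le> 64 * real m"
        using ks member_le_sum[of i "{..<m}" "\<lambda>i. (real_of_int (k i))\<^sup>2"] that by force
      hence "real_of_int ((k i)\<^sup>2) \<le> real_of_int (int (64 * m))" by simp
      hence "(k i)\<^sup>2 \<le> int (64 * m)" by (simp only: of_int_le_iff)
      thus ?thesis using abs_le_square_int[of "k i"] by auto
    qed
    hence kF: "k \<in> F" using ks by (auto simp: F_def k_def)
    have "(\<Sum>i<m. (x i - real_of_int (k i) / s)\<^sup>2) \<le> (\<Sum>i<m. 1 / s\<^sup>2)"
    proof (intro sum_mono)
      fix i assume "i \<in> {..<m}"
      hence "(s * x i - real_of_int (k i))\<^sup>2 \<le> 1" using k1(2)[of i] by (simp add: abs_square_le_1)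
      moreover have "x i - real_of_int (k i) / s = (s * x i - real_of_int (k i)) / s"
        using s by (simp add: field_simps)
      ultimately show "(x i - real_of_int (k i) / s)\<^sup>2 \<le> 1 / s\<^sup>2"
        using s by (simp add: power_divide divide_right_mono)
    qed
    also have "\<dots> = 1 / 64" using s m by simp
    finally show ?thesis using kF by (auto simp: T_def)
  qed
  ultimately show ?thesis by (rule that)
qed

text \<open>With \<open>u = x - y\<close> and \<open>v = x + y\<close> one has
  \<open>4 * (Q x - Q y) = Q (4 * u + v / 4) - Q (4 * u - v / 4)\<close>, and both arguments lie in the unit ball
  when \<open>u\<close> has norm at most \<open>1 / 8\<close>. Hence the supremum \<open>S\<close> satisfies \<open>S \<le> c + S / 2\<close>.\<close>
lemma quadratic_form_le_of_net:
  fixes q :: "nat \<Rightarrow> nat \<Rightarrow> real" and m :: nat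
  defines "Q \<equiv> \<lambda>z. \<Sum>i<m. \<Sum>j<m. q i j * z i * z j"
  assumes T1: "\<And>y. y \<in> T \<Longrightarrow> (\<Sum>i<m. (y i)\<^sup>2) \<le> 1"
    and T: "\<And>x. (\<Sum>i<m. (x i)\<^sup>2) \<le> 1 \<Longrightarrow> \<exists>y\<in>T. (\<Sum>i<m. (x i - y i)\<^sup>2) \<le> 1 / 64"
    and c: "\<And>y. y \<in> T \<Longrightarrow> \<bar>Q y\<bar> \<le> c"
    and x: "(\<Sum>i<m. (x i)\<^sup>2) \<le> 1"
  shows "\<bar>Q x\<bar> \<le> 2 * c"
proof -
  define U where "U = {x::nat \<Rightarrow> real. (\<Sum>i<m. (x i)\<^sup>2) \<le> 1}"
  define S where "S = (SUP x\<in>U. \<bar>Q x\<bar>)"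
  \<comment> \<open>Finiteness of the supremum is what allows \<open>S / 2\<close> to be cancelled
    in \<open>S \<le> c + S / 2\<close>.\<close>
  have bdd: "bdd_above ((\<lambda>x. \<bar>Q x\<bar>) ` U)"
  proof (rule bdd_aboveI2)
    fix z assume z: "z \<in> U"
    have z1: "\<bar>z i\<bar> \<le> 1" if "i < m" for i
    proof -
      have "(z i)\<^sup>2 \<le> 1" using z member_le_sum[of i "{..<m}" "\<lambda>i. (z i)\<^sup>2"] that by (force simp: U_def)
      thus ?thesis by (simp add: abs_square_le_1)
    qed
    have "\<bar>Q z\<bar> \<le> (\<Sum>i<m. \<bar>\<Sum>j<m. q i j * z i * z j\<bar>)" unfolding Q_def by (rule sum_abs)
    also have "\<dots> \<le> (\<Sum>i<m. \<Sum>j<m. \<bar>q i j * z i * z j\<bar>)" by (intro sum_mono sum_abs)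
    also have "\<dots> \<le> (\<Sum>i<m. \<Sum>j<m. \<bar>q i j\<bar>)"
    proof (intro sum_mono)
      fix i j assume "i \<in> {..<m}" "j \<in> {..<m}"
      hence "\<bar>z i\<bar> * \<bar>z j\<bar> \<le> 1 * 1" by (intro mult_mono z1) auto
      hence "\<bar>q i j\<bar> * (\<bar>z i\<bar> * \<bar>z j\<bar>) \<le> \<bar>q i j\<bar> * 1" by (intro mult_left_mono) auto
      thus "\<bar>q i j * z i * z j\<bar> \<le> \<bar>q i j\<bar>" by (simp add: abs_mult mult_ac)
    qed
    finally show "\<bar>Q z\<bar> \<le> (\<Sum>i<m. \<Sum>j<m. \<bar>q i j\<bar>)" .
  qed
  have le_S: "\<bar>Q z\<bar> \<le> S" if "z \<in> U" for z
    unfolding S_def by (intro cSUP_upper that bdd)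
  have step: "\<bar>Q x\<bar> \<le> c + S / 2" if x: "x \<in> U" for x
  proof -
    obtain y where y: "y \<in> T" "(\<Sum>i<m. (x i - y i)\<^sup>2) \<le> 1 / 64" using T x by (auto simp: U_def)
    have in_U: "(\<lambda>i. 4 * (x i - y i) + e * (x i + y i) / 4) \<in> U" if e: "e = 1 \<or> e = -1" for e
    proof -
      \<comment> \<open>Here \<open>a\<close> stands for \<open>x i - y i\<close> and
        \<open>b\<close> for \<open>x i + y i\<close>. The weights are matched to the net: the first
        part sums to at most \<open>32 / 64\<close>, the second to at most
        \<open>(1 + 1) / 4\<close>, hence \<open>1\<close> in total.\<close>
      have *: "(4 * a + e * b / 4)\<^sup>2 \<le> 32 * a\<^sup>2 + b\<^sup>2 / 8" for a b :: real
        using e zero_le_power2[of "4 * a - e * b / 4"] by (auto simp: power2_eq_square algebra_simps)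
      have "(\<Sum>i<m. (4 * (x i - y i) + e * (x i + y i) / 4)\<^sup>2)
          \<le> (\<Sum>i<m. 32 * (x i - y i)\<^sup>2 + (x i + y i)\<^sup>2 / 8)" by (intro sum_mono *)
      also have "\<dots> \<le> (\<Sum>i<m. 32 * (x i - y i)\<^sup>2 + (2 * (x i)\<^sup>2 + 2 * (y i)\<^sup>2) / 8)"
      proof (intro sum_mono add_left_mono divide_right_mono)
        fix i show "(x i + y i)\<^sup>2 \<le> 2 * (x i)\<^sup>2 + 2 * (y i)\<^sup>2"
          using zero_le_power2[of "x i - y i"] by (simp add: power2_eq_square algebra_simps)
      qed auto
      also have "\<dots> = 32 * (\<Sum>i<m. (x i - y i)\<^sup>2) + ((\<Sum>i<m. (x i)\<^sup>2) + (\<Sum>i<m. (y i)\<^sup>2)) / 4"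
        by (simp add: sum.distrib sum_distrib_left sum_divide_distrib add_divide_distrib)
      also have "\<dots> \<le> 32 * (1 / 64) + (1 + 1) / 4"
        using y T1[OF y(1)] x unfolding U_def by (intro add_mono mult_left_mono divide_right_mono) auto
      finally show ?thesis unfolding U_def by simp
    qed
    have "Q (\<lambda>i. 4 * (x i - y i) + 1 * (x i + y i) / 4) - Q (\<lambda>i. 4 * (x i - y i) + (-1) * (x i + y i) / 4)
        = 4 * (Q x - Q y)"
      unfolding Q_def sum_subtractf[symmetric] sum_distrib_left
      by (intro sum.cong refl) (simp add: field_simps)
    hence "4 * \<bar>Q x - Q y\<bar> \<le> S + S"
      using le_S[OF in_U[of 1]] le_S[OF in_U[of "-1"]] by linarith
    hence "\<bar>Q x - Q y\<bar> \<le> S / 2" by simp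
    moreover have "\<bar>Q x\<bar> \<le> \<bar>Q x - Q y\<bar> + \<bar>Q y\<bar>"
      using abs_triangle_ineq[of "Q x - Q y" "Q y"] by simp
    ultimately show ?thesis using c[OF y(1)] by simp
  qed
  have "S \<le> c + S / 2" unfolding S_def
  proof (rule cSUP_least)
    show "U \<noteq> {}" using x by (auto simp: U_def)
  qed (use step in \<open>simp add: S_def\<close>)
  thus ?thesis using le_S[of x] x by (simp add: U_def)
qed

subsection \<open>Orthonormal families and the smallest singular value\<close>

text \<open>Vectors are plain functions of which only the coordinates below \<open>n\<close> count,
  so linear combinations need no carrier conditions and the dimension remains a value.\<close>

definition inner_upto :: "nat \<Rightarrow> (nat \<Rightarrow> real) \<Rightarrow> (nat \<Rightarrow> real) \<Rightarrow> real" where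
  "inner_upto n f g = (\<Sum>i<n. f i * g i)"

lemma inner_upto_commute: "inner_upto n f g = inner_upto n g f"
  by (simp add: inner_upto_def mult.commute)

lemma inner_upto_add_right: "inner_upto n f (\<lambda>i. g i + h i) = inner_upto n f g + inner_upto n f h"
  by (simp add: inner_upto_def algebra_simps sum.distrib)

lemma inner_upto_diff_right: "inner_upto n f (\<lambda>i. g i - h i) = inner_upto n f g - inner_upto n f h"
  by (simp add: inner_upto_def algebra_simps sum_subtractf)

lemma inner_upto_scale_right: "inner_upto n f (\<lambda>i. c * g i) = c * inner_upto n f g"
  by (simp add: inner_upto_def sum_distrib_left mult_ac)

lemma inner_upto_sum_right: "inner_upto n f (\<lambda>i. \<Sum>k\<in>K. c k * v k i) = (\<Sum>k\<in>K. c k * inner_upto n f (v k))"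
  unfolding inner_upto_def sum_distrib_left
  by (subst sum.swap) (simp add: mult_ac)

lemma inner_upto_cong:
  "(\<And>i. i < n \<Longrightarrow> f i = f' i) \<Longrightarrow> (\<And>i. i < n \<Longrightarrow> g i = g' i) \<Longrightarrow> inner_upto n f g = inner_upto n f' g'"
  by (simp add: inner_upto_def)

lemma inner_upto_self_nonneg: "inner_upto n f f \<ge> 0"
  by (auto simp: inner_upto_def intro: sum_nonneg)

lemma inner_upto_self_eq_0: "inner_upto n f f = 0 \<Longrightarrow> i < n \<Longrightarrow> f i = 0"
  by (auto simp: inner_upto_def sum_nonneg_eq_0_iff)

definition orthonormal :: "nat \<Rightarrow> nat \<Rightarrow> (nat \<Rightarrow> nat \<Rightarrow> real) \<Rightarrow> bool" where
  "orthonormal n r v \<longleftrightarrow> (\<forall>k<r. \<forall>l<r. inner_upto n (v k) (v l) = (if k = l then 1 else 0))"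

text \<open>For an orthonormal family this is the orthogonal projection onto its span. Membership of
  \<open>w\<close> in the span is expressed below by \<open>projection n r v w i = w i\<close> for
  all \<open>i < n\<close>.\<close>

definition projection :: "nat \<Rightarrow> nat \<Rightarrow> (nat \<Rightarrow> nat \<Rightarrow> real) \<Rightarrow> (nat \<Rightarrow> real) \<Rightarrow> nat \<Rightarrow> real" where
  "projection n r v w i = (\<Sum>k<r. inner_upto n (v k) w * v k i)"

lemma inner_upto_projection:
  assumes "orthonormal n r v" "l < r"
  shows "inner_upto n (v l) (projection n r v w) = inner_upto n (v l) w"
proof -
  have "inner_upto n (v l) (projection n r v w) = (\<Sum>k<r. inner_upto n (v k) w * inner_upto n (v l) (v k))"
    unfolding projection_def[abs_def] by (rule inner_upto_sum_right)
  also have "\<dots> = (\<Sum>k<r. if k = l then inner_upto n (v k) w else 0)"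
    using assms by (intro sum.cong) (auto simp: orthonormal_def)
  finally show ?thesis using assms by simp
qed

lemma projection_linear:
  "projection n r v (\<lambda>i. \<Sum>s\<in>K. c s * g s i) i = (\<Sum>s\<in>K. c s * projection n r v (g s) i)"
proof -
  have "projection n r v (\<lambda>i. \<Sum>s\<in>K. c s * g s i) i
      = (\<Sum>k<r. \<Sum>s\<in>K. c s * (inner_upto n (v k) (g s) * v k i))"
    unfolding projection_def inner_upto_sum_right by (simp add: sum_distrib_left mult_ac)
  also have "\<dots> = (\<Sum>s\<in>K. c s * projection n r v (g s) i)"
    by (subst sum.swap) (simp add: projection_def sum_distrib_left)
  finally show ?thesis .
qed

text \<open>Gram-Schmidt. A vector whose residual \<open>e\<close> vanishes is skipped, which is why
  the family may be shorter than the list.\<close>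

lemma exists_orthonormal_spanning:
  "\<exists>r v. r \<le> length ws \<and> orthonormal n r v \<and> (\<forall>w\<in>set ws. \<forall>i<n. projection n r v w i = w i)"
proof (induction ws)
  case Nil
  show ?case by (intro exI[of _ 0]) (auto simp: orthonormal_def)
next
  case (Cons w ws)
  then obtain r v where r: "r \<le> length ws" and v: "orthonormal n r v"
    and P: "\<And>w i. w \<in> set ws \<Longrightarrow> i < n \<Longrightarrow> projection n r v w i = w i" by blast
  define e where "e = (\<lambda>i. w i - projection n r v w i)"
  define c where "c = inner_upto n e e"
  have ve: "inner_upto n (v k) e = 0" if "k < r" for k
    unfolding e_def using that v by (simp add: inner_upto_diff_right inner_upto_projection)
  show ?case
  proof (cases "c = 0")
    case True
    hence "projection n r v w i = w i" if "i < n" for i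
      using inner_upto_self_eq_0[of n e i] that by (auto simp: c_def e_def)
    thus ?thesis using r v P by (intro exI[of _ r] exI[of _ v]) auto
  next
    case False
    hence c: "c > 0" using inner_upto_self_nonneg[of n e] by (simp add: c_def less_le)
    define u where "u = (\<lambda>i. 1 / sqrt c * e i)"
    define v' where "v' = v(r := u)"
    have uv: "inner_upto n (v k) u = 0" if "k < r" for k
      unfolding u_def inner_upto_scale_right using ve[OF that] by simp
    have vu: "inner_upto n u (v k) = 0" if "k < r" for k
      using uv[OF that] by (simp add: inner_upto_commute)
    have ue: "inner_upto n u e = 1 / sqrt c * c"
      unfolding u_def c_def by (rule trans[OF inner_upto_commute inner_upto_scale_right])
    have uu: "inner_upto n u u = 1"
    proof -
      have "inner_upto n u u = 1 / sqrt c * inner_upto n u e"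
        by (subst (2) u_def) (rule inner_upto_scale_right)
      thus ?thesis using c by (simp add: ue)
    qed
    have on: "orthonormal n (Suc r) v'"
      unfolding orthonormal_def
    proof (intro allI impI)
      fix k l assume "k < Suc r" "l < Suc r"
      thus "inner_upto n (v' k) (v' l) = (if k = l then 1 else 0)"
        using v uv uu vu by (auto simp: v'_def orthonormal_def less_Suc_eq)
    qed
    have proj: "projection n (Suc r) v' x i = projection n r v x i + inner_upto n u x * u i" for x i
      by (simp add: projection_def v'_def)
    have 1: "projection n (Suc r) v' x i = x i" if x: "x \<in> set ws" "i < n" for x i
    proof -
      have "inner_upto n u x = inner_upto n u (projection n r v x)"
        using P[OF x(1)] by (intro inner_upto_cong) auto
      also have "\<dots> = (\<Sum>k<r. inner_upto n (v k) x * inner_upto n u (v k))"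
        unfolding projection_def[abs_def] by (rule inner_upto_sum_right)
      also have "\<dots> = 0" using vu by simp
      finally show ?thesis using P[OF x] by (simp add: proj)
    qed
    have 2: "projection n (Suc r) v' w i = w i" for i
    proof -
      have "(\<lambda>i. projection n r v w i + e i) = w" by (auto simp: e_def)
      hence "inner_upto n u w = inner_upto n u (projection n r v w) + inner_upto n u e"
        using inner_upto_add_right[of n u "projection n r v w" e] by simp
      also have "inner_upto n u (projection n r v w) = (\<Sum>k<r. inner_upto n (v k) w * inner_upto n u (v k))"
        unfolding projection_def[abs_def] by (rule inner_upto_sum_right)
      also have "\<dots> = 0" using vu by simp
      also note ue
      finally have "inner_upto n u w * u i = e i" using c by (simp add: u_def)
      thus ?thesis by (simp add: proj e_def)
    qed
    show ?thesis using r on 1 2 by (intro exI[of _ "Suc r"] exI[of _ v']) auto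
  qed
qed

text \<open>Pythagoras in the orthogonal complement of the span of \<open>v\<close>, where \<open>a\<close> vanishes.\<close>
lemma norm_perturbation_ge:
  assumes v: "orthonormal n r v" and a: "\<And>i. i < n \<Longrightarrow> projection n r v a i = a i"
  shows "inner_upto n e e - (\<Sum>k<r. (inner_upto n (v k) e)\<^sup>2) \<le> inner_upto n (\<lambda>i. a i + e i) (\<lambda>i. a i + e i)"
proof -
  define pe where "pe = projection n r v e"
  define q where "q = (\<lambda>i. e i - pe i)"
  define p where "p = (\<lambda>i. a i + pe i)"
  have proj: "inner_upto n f (projection n r v w) = (\<Sum>k<r. inner_upto n (v k) w * inner_upto n f (v k))" for f w
    unfolding projection_def[abs_def] by (rule inner_upto_sum_right)
  have vq: "inner_upto n q (v k) = 0" if "k < r" for k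
  proof -
    have "inner_upto n (v k) q = 0"
      unfolding q_def pe_def using that v by (simp add: inner_upto_diff_right inner_upto_projection)
    thus ?thesis by (simp add: inner_upto_commute)
  qed
  have qa: "inner_upto n q a = 0"
  proof -
    have "inner_upto n q a = inner_upto n q (projection n r v a)" using a by (intro inner_upto_cong) auto
    thus ?thesis using vq by (simp add: proj)
  qed
  have qpe: "inner_upto n q pe = 0" using vq by (simp add: proj pe_def)
  have qp: "inner_upto n q p = 0" unfolding p_def inner_upto_add_right using qa qpe by simp
  have epe: "inner_upto n e pe = (\<Sum>k<r. (inner_upto n (v k) e)\<^sup>2)"
    unfolding pe_def proj by (simp add: power2_eq_square inner_upto_commute[of n e "v _"])
  have e: "e = (\<lambda>i. q i + pe i)" by (auto simp: q_def)
  have "inner_upto n e e = inner_upto n e q + inner_upto n e pe"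
    by (subst (2) e) (rule inner_upto_add_right)
  also have "inner_upto n e q = inner_upto n q q"
  proof -
    have "inner_upto n q e = inner_upto n q q + inner_upto n q pe" by (subst e) (rule inner_upto_add_right)
    thus ?thesis using qpe by (simp add: inner_upto_commute)
  qed
  finally have "inner_upto n e e - (\<Sum>k<r. (inner_upto n (v k) e)\<^sup>2) = inner_upto n q q"
    using epe by simp
  moreover have "inner_upto n (\<lambda>i. a i + e i) (\<lambda>i. a i + e i) = inner_upto n p p + 2 * inner_upto n q p + inner_upto n q q"
  proof -
    have "(\<lambda>i. a i + e i) = (\<lambda>i. p i + q i)" by (auto simp: p_def q_def)
    thus ?thesis by (simp add: inner_upto_def algebra_simps sum.distrib sum_distrib_left)
  qed
  ultimately show ?thesis using qp inner_upto_self_nonneg[of n p] by simp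
qed

text \<open>A maximal independent set of columns has \<open>r\<close> elements and spans all
  columns. Gram-Schmidt on it gives the family, and the fixed-point property of the projection
  passes to linear combinations, first to the columns and then to every \<open>A x\<close>.\<close>

lemma exists_orthonormal_column_space:
  fixes A :: "real mat"
  assumes A: "A \<in> carrier_mat n d" and rank: "vec_space.rank n A = r"
  obtains r' v where "r' \<le> r" "orthonormal n r' v"
    "\<And>x i. i < n \<Longrightarrow> projection n r' v (\<lambda>i. \<Sum>j<d. A $$ (i, j) * x j) i = (\<Sum>j<d. A $$ (i, j) * x j)"
proof -
  interpret vec_space "TYPE(real)" n .
  have "lin_indpt {}" by (rule finite_lin_indpt2) auto
  then obtain S where S: "finite S" "maximal S (\<lambda>T. T \<subseteq> set (cols A) \<and> lin_indpt T)"
    using maximal_exists_superset[of "set (cols A)" "\<lambda>T. T \<subseteq> set (cols A) \<and> lin_indpt T" "{}"] by auto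
  have card: "card S = r" using rank_card_indpt[OF A S(2)] rank by simp
  have Sc: "S \<subseteq> set (cols A)" "lin_indpt S" using S(2) unfolding maximal_def by auto
  have Ac: "set (cols A) \<subseteq> carrier_vec n" using A cols_dim by blast
  have Scar: "S \<subseteq> carrier_vec n" using Sc Ac by auto
  have in_span: "c \<in> span S" if c: "c \<in> set (cols A)" for c
  proof (rule ccontr)
    assume nc: "c \<notin> span S"
    have cc: "c \<in> carrier_vec n" using c Ac by auto
    have cS: "c \<notin> S" using nc span_mem[of S c] Scar by auto
    have "lin_indpt (S \<union> {c})"
      using lin_dep_iff_in_span[of S c] Scar Sc cc cS nc by auto
    hence "S \<union> {c} = S" using S(2) Sc c unfolding maximal_def by auto
    thus False using cS by auto
  qed
  obtain ws where ws: "set ws = S" "length ws = r"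
    using finite_distinct_list[OF S(1)] distinct_card card by metis
  obtain r' v where r': "r' \<le> r" and v: "orthonormal n r' v"
    and P: "\<And>w i. w \<in> S \<Longrightarrow> i < n \<Longrightarrow> projection n r' v (($) w) i = w $ i"
    using exists_orthonormal_spanning[of "map ($) ws" n] ws by auto
  have col: "projection n r' v (\<lambda>i. A $$ (i, j)) i = A $$ (i, j)" if j: "j < d" and i: "i < n" for i j
  proof -
    have "col A j \<in> span S" using in_span j A by (auto simp: cols_def)
    hence "\<exists>a. lincomb a S = col A j" using finite_in_span[OF S(1)] Scar by auto
    then obtain a where a: "col A j = lincomb a S" by metis
    have idx: "A $$ (i, j) = (\<Sum>x\<in>S. a x * x $ i)" if "i < n" for i
      using arg_cong[OF a, of "\<lambda>c :: real vec. c $ i"] lincomb_index[OF that Scar, of a] that j A by auto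
    have "projection n r' v (\<lambda>i. A $$ (i, j)) i = projection n r' v (\<lambda>i. \<Sum>x\<in>S. a x * x $ i) i"
      unfolding projection_def using idx by (intro sum.cong refl arg_cong2[of _ _ _ _ "(*)"] inner_upto_cong) auto
    also have "\<dots> = (\<Sum>x\<in>S. a x * projection n r' v (($) x) i)"
      by (rule projection_linear)
    also have "\<dots> = A $$ (i, j)" using P i by (simp add: idx)
    finally show ?thesis .
  qed
  show ?thesis
  proof (rule that[OF r' v])
    fix x :: "nat \<Rightarrow> real" and i assume i: "i < n"
    have "projection n r' v (\<lambda>i. \<Sum>j<d. x j * A $$ (i, j)) i = (\<Sum>j<d. x j * projection n r' v (\<lambda>i. A $$ (i, j)) i)"
      by (rule projection_linear)
    thus "projection n r' v (\<lambda>i. \<Sum>j<d. A $$ (i, j) * x j) i = (\<Sum>j<d. A $$ (i, j) * x j)"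
      using col i by (simp add: mult.commute)
  qed
qed

section \<open>The Gram matrix: real spectrum and smallest eigenvalue\<close>

text \<open>For a complex eigenvector \<open>v\<close> the Hermitian form \<open>q\<close> equals
  its own conjugate and also \<open>z\<close> times the squared norm of \<open>v\<close>. This is
  needed to know how many real roots the characteristic polynomial has.\<close>

lemma symmetric_complex_eigenvalue_real:
  fixes G :: "real mat"
  assumes G: "G \<in> carrier_mat d d" and sym: "transpose_mat G = G"
    and z: "poly (map_poly complex_of_real (char_poly G)) z = 0"
  shows "Im z = 0"
proof -
  define H where "H = map_mat complex_of_real G"
  have H: "H \<in> carrier_mat d d" using G by (simp add: H_def)
  have "eigenvalue H z"
    using z of_real_hom.char_poly_hom[OF G, where 'a = complex] eigenvalue_root_char_poly[OF H, of z] unfolding H_def by simp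
  then obtain v where v: "v \<in> carrier_vec d" "v \<noteq> 0\<^sub>v d" "H *\<^sub>v v = z \<cdot>\<^sub>v v"
    using H by (auto simp: eigenvalue_def eigenvector_def)
  have Gs: "G $$ (i, j) = G $$ (j, i)" if "i < d" "j < d" for i j
    using arg_cong[OF sym, of "\<lambda>M. M $$ (i, j)"] that G by simp
  have ev: "(\<Sum>j<d. complex_of_real (G $$ (i, j)) * v $ j) = z * v $ i" if i: "i < d" for i
    using arg_cong[OF v(3), of "\<lambda>w :: complex vec. w $ i"] i G v(1)
    by (simp add: H_def scalar_prod_def atLeast0LessThan)
  define q where "q = (\<Sum>i<d. \<Sum>j<d. cnj (v $ i) * complex_of_real (G $$ (i, j)) * v $ j)"
  define s where "s = (\<Sum>i<d. (cmod (v $ i))\<^sup>2)"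
  have q: "q = z * complex_of_real s"
  proof -
    have "q = (\<Sum>i<d. cnj (v $ i) * (z * v $ i))"
      unfolding q_def by (intro sum.cong refl) (simp add: ev[symmetric] sum_distrib_left mult.assoc)
    also have "\<dots> = z * (\<Sum>i<d. v $ i * cnj (v $ i))" by (simp add: sum_distrib_left mult_ac)
    also have "(\<Sum>i<d. v $ i * cnj (v $ i)) = complex_of_real s"
      unfolding s_def of_real_sum by (intro sum.cong refl complex_norm_square[symmetric])
    finally show ?thesis .
  qed
  have "cnj q = (\<Sum>i<d. \<Sum>j<d. cnj (v $ j) * complex_of_real (G $$ (j, i)) * v $ i)"
    unfolding q_def cnj_sum by (intro sum.cong refl) (simp add: Gs mult_ac)
  also have "\<dots> = q" unfolding q_def by (rule sum.swap)
  finally have "Im q = 0" by (metis Reals_cnj_iff complex_is_Real_iff)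
  hence "Im z * s = 0" by (simp add: q)
  moreover have "s \<noteq> 0"
  proof
    assume "s = 0"
    hence "v $ i = 0" if "i < d" for i using that by (simp add: s_def sum_nonneg_eq_0_iff)
    hence "v = 0\<^sub>v d" using v(1) by auto
    thus False using v(2) by contradiction
  qed
  ultimately show ?thesis by simp
qed

text \<open>A complex root exists and is real by hypothesis; after dividing out its linear factor,
  the cofactor inherits the hypothesis because its complex roots are roots of
  \<open>p\<close>.\<close>

lemma size_proots_real_rooted:
  fixes p :: "real poly"
  assumes "p \<noteq> 0" and "\<And>z. poly (map_poly complex_of_real p) z = 0 \<Longrightarrow> Im z = 0"
  shows "size (proots p) = degree p"
  using assms
proof (induction "degree p" arbitrary: p)
  case 0
  thus ?case using size_proots_le[of p] by simp
next
  case (Suc m)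
  have "\<not> constant (poly (map_poly complex_of_real p))"
    using Suc.hyps(2) by (simp add: constant_degree)
  then obtain z where z: "poly (map_poly complex_of_real p) z = 0"
    using fundamental_theorem_of_algebra by blast
  define x where "x = Re z"
  have "z = complex_of_real x" using Suc.prems(2)[OF z] by (simp add: x_def complex_eq_iff)
  hence "poly p x = 0" using z by simp
  then obtain q where q: "p = [:- x, 1:] * q" by (metis dvdE poly_eq_0_iff_dvd)
  have q0: "q \<noteq> 0" using q Suc.prems(1) by auto
  have "degree p = degree [:- x, 1:] + degree q"
    unfolding q using q0 by (intro degree_mult_eq) auto
  hence deg: "degree p = Suc (degree q)" by simp
  interpret map_of_real: map_poly_comm_ring_hom complex_of_real ..
  have "poly (map_poly complex_of_real p) y = (y - complex_of_real x) * poly (map_poly complex_of_real q) y" for y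
    unfolding q map_of_real.hom_mult by (simp add: algebra_simps)
  hence "size (proots q) = degree q"
    using Suc deg q0 by (intro Suc.hyps(1)) auto
  thus ?case using q0 deg Suc.prems(1) by (simp add: q proots_mult del: mult_pCons_left)
qed

text \<open>\<open>singular_value d A\<close> reads position \<open>d - 1\<close> of a list of real
  roots, so the length of that list must first be shown to be \<open>d\<close>. After that it
  suffices to bound every eigenvalue of the Gram matrix, and each is the Rayleigh quotient of its
  own eigenvector, to which \<open>low\<close> applies after normalisation.\<close>

lemma singular_value_ge:
  fixes A :: "real mat"
  assumes A: "A \<in> carrier_mat n d" and d: "d \<ge> 1" and c: "c \<ge> 0"
    and low: "\<And>x. (\<Sum>j<d. (x j)\<^sup>2) = 1 \<Longrightarrow> c\<^sup>2 \<le> (\<Sum>i<n. (\<Sum>j<d. A $$ (i, j) * x j)\<^sup>2)"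
  shows "c \<le> singular_value d A"
proof -
  define G where "G = transpose_mat A * A"
  have G: "G \<in> carrier_mat d d" using A by (auto simp: G_def)
  have sym: "transpose_mat G = G" using A by (auto simp: G_def transpose_mult)
  have deg: "degree (char_poly G) = d" "char_poly G \<noteq> 0"
    using degree_monic_char_poly[OF G] by auto
  have size: "size (proots (char_poly G)) = d"
    using size_proots_real_rooted[OF deg(2)] symmetric_complex_eigenvalue_real[OF G sym] deg(1) by simp
  have root: "c \<le> sqrt l" if l: "l \<in># proots (char_poly G)" for l
  proof -
    have "poly (char_poly G) l = 0" using l deg(2) by simp
    hence "eigenvalue G l" by (simp add: eigenvalue_root_char_poly[OF G])
    then obtain v where v: "v \<in> carrier_vec d" "v \<noteq> 0\<^sub>v d" "G *\<^sub>v v = l \<cdot>\<^sub>v v"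
      using G by (auto simp: eigenvalue_def eigenvector_def)
    define s where "s = (\<Sum>j<d. (v $ j)\<^sup>2)"
    have s: "s > 0"
    proof (rule ccontr)
      assume "\<not> s > 0"
      hence "s = 0" using sum_nonneg[of "{..<d}" "\<lambda>j. (v $ j)\<^sup>2"] by (simp add: s_def)
      hence "v $ i = 0" if "i < d" for i using that by (simp add: s_def sum_nonneg_eq_0_iff)
      hence "v = 0\<^sub>v d" using v(1) by auto
      thus False using v(2) by contradiction
    qed
    define Q where "Q = (\<Sum>i<n. (\<Sum>j<d. A $$ (i, j) * v $ j)\<^sup>2)"
    have "l * s = (G *\<^sub>v v) \<bullet> v"
      using v(1) unfolding v(3)
      by (simp add: scalar_prod_def s_def power2_eq_square atLeast0LessThan sum_distrib_left mult.assoc)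
    also have "G *\<^sub>v v = transpose_mat A *\<^sub>v (A *\<^sub>v v)"
      unfolding G_def using A v(1) by (intro assoc_mult_mat_vec) auto
    also have "\<dots> \<bullet> v = (A *\<^sub>v v) \<bullet> (A *\<^sub>v v)"
      using A v(1) by (intro transpose_vec_mult_scalar) auto
    also have "\<dots> = Q"
      using A v(1) by (simp add: scalar_prod_def Q_def power2_eq_square atLeast0LessThan)
    finally have lQ: "l * s = Q" .
    have "c\<^sup>2 \<le> (\<Sum>i<n. (\<Sum>j<d. A $$ (i, j) * (v $ j / sqrt s))\<^sup>2)"
      using s by (intro low) (simp add: power_divide s_def[symmetric] sum_divide_distrib[symmetric])
    also have "\<dots> = Q / s"
      using s by (simp add: Q_def power_divide sum_divide_distrib[symmetric])
    also have "\<dots> = l" using lQ s by (simp add: field_simps)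
    finally show ?thesis using c real_le_rsqrt by blast
  qed
  define xs where "xs = singular_values A"
  have len: "length xs = d"
    unfolding xs_def singular_values_def G_def[symmetric]
    by (metis length_rev mset_sorted_list_of_multiset size_image_mset size_mset size)
  have set: "set xs = sqrt ` set_mset (proots (char_poly G))"
    by (simp add: xs_def singular_values_def G_def)
  have "xs ! (d - 1) \<in> set xs" using len d by (intro nth_mem) auto
  thus ?thesis using root unfolding set singular_value_def xs_def[symmetric] by auto
qed

subsection \<open>Uniform deviation bounds\<close>

lemma prob_Un_le_card:
  assumes "finite T" "\<And>y. y \<in> T \<Longrightarrow> measure_pmf.prob P (E y) \<le> c"
  shows "measure_pmf.prob P (\<Union>y\<in>T. E y) \<le> real (card T) * c"
proof -
  have "measure_pmf.prob P (\<Union>y\<in>T. E y) \<le> (\<Sum>y\<in>T. measure_pmf.prob P (E y))"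
    using assms(1) by (intro measure_pmf.finite_measure_subadditive_finite) auto
  also have "\<dots> \<le> (\<Sum>y\<in>T. c)" by (intro sum_mono assms)
  finally show ?thesis by simp
qed

lemma sum_lessThan_add:
  fixes g :: "nat \<Rightarrow> real"
  shows "(\<Sum>a<d + r. g a) = (\<Sum>a<d. g a) + (\<Sum>k<r. g (d + k))"
  by (induction r) (auto simp: add_ac)

lemma orthonormal_norm:
  assumes v: "orthonormal n r v"
  shows "(\<Sum>i<n. (\<Sum>k<r. c k * v k i)\<^sup>2) = (\<Sum>k<r. (c k)\<^sup>2)"
proof -
  have "(\<Sum>i<n. (\<Sum>k<r. c k * v k i)\<^sup>2) = inner_upto n (\<lambda>i. \<Sum>k<r. c k * v k i) (\<lambda>i. \<Sum>k<r. c k * v k i)"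
    by (simp add: inner_upto_def power2_eq_square)
  also have "\<dots> = (\<Sum>k<r. c k * inner_upto n (v k) (\<lambda>i. \<Sum>k<r. c k * v k i))"
    by (subst inner_upto_sum_right) (simp add: inner_upto_commute)
  also have "\<dots> = (\<Sum>k<r. c k * (\<Sum>l<r. c l * inner_upto n (v k) (v l)))"
    by (simp only: inner_upto_sum_right)
  also have "\<dots> = (\<Sum>k<r. c k * (\<Sum>l<r. if l = k then c l else 0))"
    using v by (intro sum.cong refl arg_cong2[of _ _ _ _ "(*)"]) (auto simp: orthonormal_def)
  finally show ?thesis by (simp add: power2_eq_square)
qed

text \<open>The entries are functions \<open>f ij\<close> of independent raw draws
  \<open>w ij\<close>. In the application the draws are the rounded entries themselves, while
  centring, scaling by the resolution and shrinking of the columns all go into \<open>f\<close>, so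
  the law stays that of the rounding.\<close>

locale random_matrix =
  fixes n d :: nat and p :: "nat \<times> nat \<Rightarrow> 'b pmf" and f :: "nat \<times> nat \<Rightarrow> 'b \<Rightarrow> real" and dflt :: 'b
  assumes d: "d \<ge> 1"
    and fin: "\<And>ij. ij \<in> {..<n} \<times> {..<d} \<Longrightarrow> finite (set_pmf (p ij))"
    and mean: "\<And>ij. ij \<in> {..<n} \<times> {..<d} \<Longrightarrow> measure_pmf.expectation (p ij) (f ij) = 0"
    and bound: "\<And>ij y. ij \<in> {..<n} \<times> {..<d} \<Longrightarrow> y \<in> set_pmf (p ij) \<Longrightarrow> \<bar>f ij y\<bar> \<le> 1"
begin

abbreviation "law \<equiv> Pi_pmf ({..<n} \<times> {..<d}) dflt p"

definition app :: "(nat \<times> nat \<Rightarrow> 'b) \<Rightarrow> (nat \<Rightarrow> real) \<Rightarrow> nat \<Rightarrow> real" where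
  "app w x i = (\<Sum>j<d. f (i, j) (w (i, j)) * x j)"

text \<open>Since all columns have variance \<open>N\<close>, the squared norm of
  \<open>app w x\<close> has mean \<open>N\<close> times that of \<open>x\<close> for every
  \<open>x\<close>, so the deviation is itself a quadratic form in \<open>x\<close> and the net
  lemma applies. Passing from the net to the ball doubles \<open>2416\<close> to
  \<open>4832\<close>; the \<open>exp (66 * real d)\<close> net points are paid for by a union
  bound.\<close>

lemma prob_quadratic_deviation:
  assumes var: "\<And>j. j < d \<Longrightarrow> (\<Sum>i<n. measure_pmf.expectation (p (i, j)) (\<lambda>y. (f (i, j) y)\<^sup>2)) = N"
    and t: "t > 0"
  shows "measure_pmf.prob law {w. \<exists>x. (\<Sum>j<d. (x j)\<^sup>2) \<le> 1 \<and>
      \<bar>(\<Sum>i<n. (app w x i)\<^sup>2) - N * (\<Sum>j<d. (x j)\<^sup>2)\<bar> > 4832 * (sqrt (N * t) + t)}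
    \<le> 2 * exp (66 * real d - t)"
proof -
  define \<tau> where "\<tau> = 2416 * (sqrt (N * t) + t)"
  define q where "q = (\<lambda>w j l. (\<Sum>i<n. f (i, j) (w (i, j)) * f (i, l) (w (i, l))) - (if j = l then N else 0))"
  define Q where "Q = (\<lambda>w x. \<Sum>j<d. \<Sum>l<d. q w j l * x j * x l)"
  have Q: "Q w x = (\<Sum>i<n. (app w x i)\<^sup>2) - N * (\<Sum>j<d. (x j)\<^sup>2)" for w x
  proof -
    have "Q w x = (\<Sum>j<d. \<Sum>l<d. \<Sum>i<n. (f (i, j) (w (i, j)) * x j) * (f (i, l) (w (i, l)) * x l))
        - (\<Sum>j<d. \<Sum>l<d. (if j = l then N else 0) * x j * x l)"
      by (simp add: Q_def q_def algebra_simps sum_subtractf sum_distrib_left)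
    also have "(\<Sum>j<d. \<Sum>l<d. (if j = l then N else 0) * x j * x l) = (\<Sum>j<d. \<Sum>l<d. if l = j then N * x j * x l else 0)"
      by (intro sum.cong) auto
    also have "\<dots> = N * (\<Sum>j<d. (x j)\<^sup>2)"
      by (simp add: sum_distrib_left power2_eq_square mult.assoc)
    also have "(\<Sum>j<d. \<Sum>l<d. \<Sum>i<n. (f (i, j) (w (i, j)) * x j) * (f (i, l) (w (i, l)) * x l))
        = (\<Sum>j<d. \<Sum>i<n. \<Sum>l<d. (f (i, j) (w (i, j)) * x j) * (f (i, l) (w (i, l)) * x l))"
      by (intro sum.cong refl sum.swap)
    also have "\<dots> = (\<Sum>i<n. \<Sum>j<d. \<Sum>l<d. (f (i, j) (w (i, j)) * x j) * (f (i, l) (w (i, l)) * x l))"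
      by (rule sum.swap)
    also have "\<dots> = (\<Sum>i<n. (app w x i)\<^sup>2)"
      by (simp add: app_def power2_eq_square sum_product)
    finally show ?thesis .
  qed
  obtain T :: "(nat \<Rightarrow> real) set" where T: "finite T" "real (card T) \<le> exp (66 * real d)"
    "\<And>y. y \<in> T \<Longrightarrow> (\<Sum>i<d. (y i)\<^sup>2) \<le> 1"
    "\<And>x. (\<Sum>i<d. (x i)\<^sup>2) \<le> 1 \<Longrightarrow> \<exists>y\<in>T. (\<Sum>i<d. (x i - y i)\<^sup>2) \<le> 1 / 64"
    using unit_ball_net[OF d] by blast
  have point: "measure_pmf.prob law {w. \<bar>Q w x\<bar> \<ge> \<tau>} \<le> 2 * exp (- t)" if x: "x \<in> T" for x
  proof -
    define g where "g = (\<lambda>(i, j) y. f (i, j) y * x j)"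
    define s where "s = (\<Sum>i<n. \<Sum>j<d. measure_pmf.expectation (p (i, j)) (\<lambda>y. (g (i, j) y)\<^sup>2))"
    have "s = (\<Sum>i<n. \<Sum>j<d. measure_pmf.expectation (p (i, j)) (\<lambda>y. (f (i, j) y)\<^sup>2) * (x j)\<^sup>2)"
      by (simp add: s_def g_def power_mult_distrib)
    also have "\<dots> = (\<Sum>j<d. \<Sum>i<n. measure_pmf.expectation (p (i, j)) (\<lambda>y. (f (i, j) y)\<^sup>2) * (x j)\<^sup>2)"
      by (rule sum.swap)
    also have "\<dots> = (\<Sum>j<d. N * (x j)\<^sup>2)"
      by (intro sum.cong refl) (simp add: sum_distrib_right[symmetric] var)
    finally have s: "s = N * (\<Sum>j<d. (x j)\<^sup>2)" by (simp add: sum_distrib_left)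
    have "N \<ge> 0"
      using var[of 0] d by (metis (no_types, lifting) Bochner_Integration.integral_nonneg less_le_trans
          less_one sum_nonneg zero_le_power2)
    hence sN: "s \<le> N" unfolding s using T(3)[OF x] mult_left_mono[of _ 1 N] by simp
    have "measure_pmf.prob law {w. \<bar>(\<Sum>i<n. (\<Sum>j<d. g (i, j) (w (i, j)))\<^sup>2)
        - (\<Sum>i<n. \<Sum>j<d. measure_pmf.expectation (p (i, j)) (\<lambda>y. (g (i, j) y)\<^sup>2))\<bar>
          \<ge> 2416 * (sqrt (N * t) + t)} \<le> 2 * exp (- t)"
    proof (rule prob_sum_squares_deviation_le[where b = "\<lambda>j. \<bar>x j\<bar>"])
      fix ij assume ij: "ij \<in> {..<n} \<times> {..<d}"
      thus "finite (set_pmf (p ij))" by (rule fin)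
      show "measure_pmf.expectation (p ij) (g ij) = 0"
        using mean[OF ij] by (cases ij) (simp add: g_def)
    next
      fix i j y assume "i \<in> {..<n}" "j \<in> {..<d}" "y \<in> set_pmf (p (i, j))"
      hence "\<bar>f (i, j) y\<bar> * \<bar>x j\<bar> \<le> 1 * \<bar>x j\<bar>" by (intro mult_right_mono bound) auto
      thus "\<bar>g (i, j) y\<bar> \<le> \<bar>x j\<bar>" by (simp add: g_def abs_mult)
    qed (use T(3)[OF x] t sN s_def in auto)
    moreover have "(\<Sum>j<d. g (i, j) (w (i, j))) = app w x i" for w i
      by (simp add: g_def app_def)
    ultimately show ?thesis using s by (simp add: s_def[symmetric] Q \<tau>_def)
  qed
  have "{w. \<exists>x. (\<Sum>j<d. (x j)\<^sup>2) \<le> 1 \<and> \<bar>Q w x\<bar> > 2 * \<tau>} \<subseteq> (\<Union>x\<in>T. {w. \<bar>Q w x\<bar> \<ge> \<tau>})"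
  proof (rule subsetI, rule ccontr)
    fix w assume w: "w \<in> {w. \<exists>x. (\<Sum>j<d. (x j)\<^sup>2) \<le> 1 \<and> \<bar>Q w x\<bar> > 2 * \<tau>}"
      and "w \<notin> (\<Union>x\<in>T. {w. \<bar>Q w x\<bar> \<ge> \<tau>})"
    hence c: "\<bar>Q w x\<bar> \<le> \<tau>" if "x \<in> T" for x using that by force
    obtain x where x: "(\<Sum>j<d. (x j)\<^sup>2) \<le> 1" "\<bar>Q w x\<bar> > 2 * \<tau>" using w by auto
    have "\<bar>Q w x\<bar> \<le> 2 * \<tau>"
      using quadratic_form_le_of_net[of T d "q w" \<tau> x] T(3,4) c x(1) unfolding Q_def by blast
    thus False using x(2) by simp
  qed
  hence "measure_pmf.prob law {w. \<exists>x. (\<Sum>j<d. (x j)\<^sup>2) \<le> 1 \<and> \<bar>Q w x\<bar> > 2 * \<tau>}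
      \<le> measure_pmf.prob law (\<Union>x\<in>T. {w. \<bar>Q w x\<bar> \<ge> \<tau>})"
    by (intro measure_pmf.finite_measure_mono) auto
  also have "\<dots> \<le> real (card T) * (2 * exp (- t))" by (intro prob_Un_le_card T(1) point)
  also have "\<dots> \<le> exp (66 * real d) * (2 * exp (- t))" by (intro mult_right_mono T(2)) auto
  also have "\<dots> = 2 * exp (66 * real d - t)" by (simp add: exp_diff exp_minus field_simps)
  finally show ?thesis by (simp add: Q \<tau>_def)
qed

text \<open>The bilinear form \<open>(y, x) \<mapsto> \<langle>\<Sum>k. y k v k, app w x\<rangle>\<close> is viewed as a quadratic form in the
  concatenation of \<open>x\<close> and \<open>y\<close>, so that the same net lemma applies.\<close>
lemma prob_projection_large:
  assumes v: "orthonormal n r v" and t: "t > 0"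
  shows "measure_pmf.prob law {w. \<exists>x. (\<Sum>j<d. (x j)\<^sup>2) \<le> 1 \<and>
      (\<Sum>k<r. (inner_upto n (v k) (app w x))\<^sup>2) > 64 * t}
    \<le> 2 * exp (66 * real (d + r) - t)"
proof -
  define c where "c = (\<lambda>w k j. \<Sum>i<n. v k i * f (i, j) (w (i, j)))"
  \<comment> \<open>Coordinates below \<open>d\<close> hold \<open>x\<close> and the following
    \<open>r\<close> hold \<open>y\<close>; only the off-diagonal block that pairs \<open>y\<close>
    with \<open>x\<close> is nonzero.\<close>
  define q where "q = (\<lambda>w a b. if d \<le> a \<and> b < d then c w (a - d) b else 0)"
  define Q where "Q = (\<lambda>w z. \<Sum>a<d + r. \<Sum>b<d + r. q w a b * z a * z b)"
  have Qc: "Q w z = (\<Sum>k<r. \<Sum>j<d. c w k j * z (d + k) * z j)" for w z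
    unfolding Q_def sum_lessThan_add by (simp add: q_def)
  have vapp: "inner_upto n (v k) (app w x) = (\<Sum>j<d. c w k j * x j)" for k w x
  proof -
    have "inner_upto n (v k) (app w x) = (\<Sum>i<n. \<Sum>j<d. v k i * f (i, j) (w (i, j)) * x j)"
      by (simp add: inner_upto_def app_def sum_distrib_left mult.assoc)
    also have "\<dots> = (\<Sum>j<d. \<Sum>i<n. v k i * f (i, j) (w (i, j)) * x j)" by (rule sum.swap)
    finally show ?thesis by (simp add: c_def sum_distrib_right)
  qed
  have m: "d + r \<ge> 1" using d by simp
  obtain T :: "(nat \<Rightarrow> real) set" where T: "finite T" "real (card T) \<le> exp (66 * real (d + r))"
    "\<And>y. y \<in> T \<Longrightarrow> (\<Sum>i<d + r. (y i)\<^sup>2) \<le> 1"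
    "\<And>x. (\<Sum>i<d + r. (x i)\<^sup>2) \<le> 1 \<Longrightarrow> \<exists>y\<in>T. (\<Sum>i<d + r. (x i - y i)\<^sup>2) \<le> 1 / 64"
    using unit_ball_net[OF m] by blast
  have point: "measure_pmf.prob law {w. \<bar>Q w z\<bar> \<ge> 2 * sqrt t} \<le> 2 * exp (- t)" if z: "z \<in> T" for z
  proof -
    define V where "V = (\<lambda>i. \<Sum>k<r. z (d + k) * v k i)"
    define g where "g = (\<lambda>(i, j) y. f (i, j) y * (V i * z j))"
    have "(\<Sum>j<d. (z j)\<^sup>2) + (\<Sum>k<r. (z (d + k))\<^sup>2) \<le> 1"
      using T(3)[OF z] by (simp add: sum_lessThan_add)
    moreover have "(\<Sum>j<d. (z j)\<^sup>2) \<ge> 0" "(\<Sum>k<r. (z (d + k))\<^sup>2) \<ge> 0" by (auto intro: sum_nonneg)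
    ultimately have z1: "(\<Sum>j<d. (z j)\<^sup>2) \<le> 1" "(\<Sum>k<r. (z (d + k))\<^sup>2) \<le> 1" 
      and z0: "(\<Sum>j<d. (z j)\<^sup>2) \<ge> 0" by auto
    \<comment> \<open>The coefficients of the entries form a rank-one matrix, whose squared
      Frobenius norm is the product of two squared norms; orthonormality identifies that of
      \<open>V\<close> with that of the \<open>y\<close> part.\<close>
    have "(\<Sum>(i, j)\<in>{..<n} \<times> {..<d}. (V i * z j)\<^sup>2) = (\<Sum>i<n. (V i)\<^sup>2) * (\<Sum>j<d. (z j)\<^sup>2)"
      by (simp add: sum.cartesian_product[symmetric] sum_product power_mult_distrib)
    also have "\<dots> = (\<Sum>k<r. (z (d + k))\<^sup>2) * (\<Sum>j<d. (z j)\<^sup>2)"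
      unfolding V_def by (subst orthonormal_norm[OF v]) simp
    also have "\<dots> \<le> 1 * 1" using z1 z0 by (intro mult_mono) auto
    finally have S: "(\<Sum>(i, j)\<in>{..<n} \<times> {..<d}. (V i * z j)\<^sup>2) \<le> 1" by simp
    have "measure_pmf.prob law {w. \<bar>\<Sum>ij\<in>{..<n} \<times> {..<d}. g ij (w ij)\<bar> \<ge> 2 * sqrt t} \<le> 2 * exp (- t)"
    proof (rule prob_abs_sum_ge_le[where b = "\<lambda>(i, j). \<bar>V i * z j\<bar>"])
      fix ij assume ij: "ij \<in> {..<n} \<times> {..<d}"
      thus "finite (set_pmf (p ij))" by (rule fin)
      show "measure_pmf.expectation (p ij) (g ij) = 0"
        using mean[OF ij] by (cases ij) (simp add: g_def)
      fix y assume "y \<in> set_pmf (p ij)"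
      hence "\<bar>f ij y\<bar> * \<bar>V (fst ij) * z (snd ij)\<bar> \<le> 1 * \<bar>V (fst ij) * z (snd ij)\<bar>"
        by (intro mult_right_mono bound ij) auto
      thus "\<bar>g ij y\<bar> \<le> (case ij of (i, j) \<Rightarrow> \<bar>V i * z j\<bar>)"
        by (cases ij) (simp add: g_def abs_mult)
    next
      show "(\<Sum>ij\<in>{..<n} \<times> {..<d}. (case ij of (i, j) \<Rightarrow> \<bar>V i * z j\<bar>)\<^sup>2) \<le> 1"
        using S by (simp add: case_prod_unfold)
    qed (use t in auto)
    moreover have "(\<Sum>ij\<in>{..<n} \<times> {..<d}. g ij (w ij)) = Q w z" for w
    proof -
      have "(\<Sum>ij\<in>{..<n} \<times> {..<d}. g ij (w ij)) = (\<Sum>i<n. \<Sum>j<d. f (i, j) (w (i, j)) * (V i * z j))"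
        by (simp add: sum.cartesian_product g_def case_prod_unfold)
      also have "\<dots> = (\<Sum>i<n. \<Sum>j<d. \<Sum>k<r. v k i * f (i, j) (w (i, j)) * z (d + k) * z j)"
        by (intro sum.cong refl) (simp add: V_def sum_distrib_left sum_distrib_right mult_ac)
      also have "\<dots> = (\<Sum>i<n. \<Sum>k<r. \<Sum>j<d. v k i * f (i, j) (w (i, j)) * z (d + k) * z j)"
        by (intro sum.cong refl sum.swap)
      also have "\<dots> = (\<Sum>k<r. \<Sum>i<n. \<Sum>j<d. v k i * f (i, j) (w (i, j)) * z (d + k) * z j)"
        by (rule sum.swap)
      also have "\<dots> = (\<Sum>k<r. \<Sum>j<d. \<Sum>i<n. v k i * f (i, j) (w (i, j)) * z (d + k) * z j)"
        by (intro sum.cong refl sum.swap)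
      finally show ?thesis by (simp add: Qc c_def sum_distrib_right)
    qed
    ultimately show ?thesis by simp
  qed
  have "{w. \<exists>x. (\<Sum>j<d. (x j)\<^sup>2) \<le> 1 \<and> (\<Sum>k<r. (inner_upto n (v k) (app w x))\<^sup>2) > 64 * t}
      \<subseteq> (\<Union>z\<in>T. {w. \<bar>Q w z\<bar> \<ge> 2 * sqrt t})"
  proof (rule subsetI, rule ccontr)
    fix w assume w: "w \<in> {w. \<exists>x. (\<Sum>j<d. (x j)\<^sup>2) \<le> 1 \<and> (\<Sum>k<r. (inner_upto n (v k) (app w x))\<^sup>2) > 64 * t}"
      and nw: "w \<notin> (\<Union>z\<in>T. {w. \<bar>Q w z\<bar> \<ge> 2 * sqrt t})"
    have c: "\<bar>Q w z\<bar> \<le> 2 * sqrt t" if "z \<in> T" for z using nw that by force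
    obtain x where x: "(\<Sum>j<d. (x j)\<^sup>2) \<le> 1" "(\<Sum>k<r. (inner_upto n (v k) (app w x))\<^sup>2) > 64 * t"
      using w by auto
    define g where "g = (\<lambda>k. inner_upto n (v k) (app w x))"
    define G where "G = (\<Sum>k<r. (g k)\<^sup>2)"
    have G: "G > 64 * t" "G > 0" using x(2) t by (auto simp: G_def g_def)
    \<comment> \<open>The \<open>y\<close> part is the normalised vector \<open>g\<close>, which
      maximises the pairing with \<open>g\<close>; the factors \<open>1 / sqrt 2\<close> put the
      concatenation into the unit ball. The form then takes the value \<open>sqrt G / 2\<close>, so
      the net bound \<open>4 * sqrt t\<close> yields \<open>G \<le> 64 * t\<close>.\<close>
    define z where "z = (\<lambda>a. if a < d then x a / sqrt 2 else g (a - d) / (sqrt 2 * sqrt G))"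
    have "(\<Sum>a<d + r. (z a)\<^sup>2) = (\<Sum>j<d. (x j)\<^sup>2) / 2 + G / (2 * G)"
      using G by (simp add: sum_lessThan_add z_def power_divide power_mult_distrib sum_divide_distrib G_def)
    also have "\<dots> \<le> 1" using x(1) G by simp
    finally have z1: "(\<Sum>a<d + r. (z a)\<^sup>2) \<le> 1" .
    have "\<bar>Q w z\<bar> \<le> 2 * (2 * sqrt t)"
      using quadratic_form_le_of_net[of T "d + r" "q w" "2 * sqrt t" z] T(3,4) c z1 unfolding Q_def by blast
    moreover have "Q w z = (\<Sum>k<r. z (d + k) * (\<Sum>j<d. c w k j * z j))"
      by (simp add: Qc sum_distrib_left mult_ac)
    moreover have "(\<Sum>j<d. c w k j * z j) = g k / sqrt 2" for k
      by (simp add: g_def vapp z_def sum_divide_distrib)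
    moreover have "(\<Sum>k<r. z (d + k) * (g k / sqrt 2)) = (\<Sum>k<r. (g k)\<^sup>2) / (2 * sqrt G)"
      unfolding sum_divide_distrib by (intro sum.cong refl) (simp add: z_def power2_eq_square)
    moreover have "(\<Sum>k<r. (g k)\<^sup>2) / (2 * sqrt G) = sqrt G / 2"
      unfolding G_def[symmetric] using G by (simp add: field_simps)
    ultimately have "sqrt G \<le> 8 * sqrt t" by simp
    hence "(sqrt G)\<^sup>2 \<le> (8 * sqrt t)\<^sup>2" using G by (intro power_mono) auto
    thus False using G t by (simp add: power_mult_distrib)
  qed
  hence "measure_pmf.prob law {w. \<exists>x. (\<Sum>j<d. (x j)\<^sup>2) \<le> 1 \<and> (\<Sum>k<r. (inner_upto n (v k) (app w x))\<^sup>2) > 64 * t}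
      \<le> measure_pmf.prob law (\<Union>z\<in>T. {w. \<bar>Q w z\<bar> \<ge> 2 * sqrt t})"
    by (intro measure_pmf.finite_measure_mono) auto
  also have "\<dots> \<le> real (card T) * (2 * exp (- t))" by (intro prob_Un_le_card T(1) point)
  also have "\<dots> \<le> exp (66 * real (d + r)) * (2 * exp (- t))" by (intro mult_right_mono T(2)) auto
  also have "\<dots> = 2 * exp (66 * real (d + r) - t)" by (simp add: exp_diff exp_minus field_simps)
  finally show ?thesis .
qed

text \<open>The coefficient \<open>67\<close> exceeds the entropy rate \<open>66\<close> of the nets
  by one: after both union bounds a factor \<open>exp (- 1)\<close> remains, and
  \<open>4 * exp (- 1) \<le> 2\<close>. The estimate is homogeneous in \<open>x\<close> because it
  will be applied to vectors of norm at least \<open>1\<close>.\<close>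

lemma prob_projected_norm_ge:
  fixes u :: real
  assumes var: "\<And>j. j < d \<Longrightarrow> (\<Sum>i<n. measure_pmf.expectation (p (i, j)) (\<lambda>y. (f (i, j) y)\<^sup>2)) = N"
    and v: "orthonormal n r v"
  defines "t \<equiv> 67 * real (d + r) + u\<^sup>2"
  defines "\<theta> \<equiv> sqrt N - 9728 * sqrt t"
  assumes \<theta>: "\<theta> \<ge> 0"
  shows "measure_pmf.prob law {w. \<forall>x. \<theta>\<^sup>2 * (\<Sum>j<d. (x j)\<^sup>2)
      \<le> (\<Sum>i<n. (app w x i)\<^sup>2) - (\<Sum>k<r. (inner_upto n (v k) (app w x))\<^sup>2)}
    \<ge> 1 - 2 * exp (- u\<^sup>2)"
proof -
  have t: "t > 0" using d by (auto simp: t_def intro!: add_pos_nonneg)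
  define E1 where "E1 = {w. \<exists>x. (\<Sum>j<d. (x j)\<^sup>2) \<le> 1 \<and>
      \<bar>(\<Sum>i<n. (app w x i)\<^sup>2) - N * (\<Sum>j<d. (x j)\<^sup>2)\<bar> > 4832 * (sqrt (N * t) + t)}"
  define E2 where "E2 = {w. \<exists>x. (\<Sum>j<d. (x j)\<^sup>2) \<le> 1 \<and>
      (\<Sum>k<r. (inner_upto n (v k) (app w x))\<^sup>2) > 64 * t}"
  define H where "H = {w. \<forall>x. \<theta>\<^sup>2 * (\<Sum>j<d. (x j)\<^sup>2)
      \<le> (\<Sum>i<n. (app w x i)\<^sup>2) - (\<Sum>k<r. (inner_upto n (v k) (app w x))\<^sup>2)}"
  have sN: "9728 * sqrt t \<le> sqrt N" using \<theta> by (simp add: \<theta>_def)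
  hence N: "N \<ge> 0" using t by (smt (verit) real_sqrt_ge_0_iff mult_nonneg_nonneg)
  \<comment> \<open>With \<open>K = 9728 = 4832 + 4832 + 64\<close> and
    \<open>K * b \<le> a\<close>, the square \<open>(a - K * b)^2\<close> is at most
    \<open>a^2 - K * a * b\<close>, and \<open>K * a * b\<close> covers
    \<open>4832 * (a * b + b * b) + 64 * (b * b)\<close> since \<open>b \<le> a\<close>.\<close>
  have arith: "\<theta>\<^sup>2 \<le> N - 4832 * (sqrt (N * t) + t) - 64 * t"
  proof -
    define a b where "a = sqrt N" and "b = sqrt t"
    have ab: "a\<^sup>2 = N" "b\<^sup>2 = t" "sqrt (N * t) = a * b" "0 \<le> b" "9728 * b \<le> a"
      using N t sN by (auto simp: a_def b_def real_sqrt_mult)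
    have 1: "9728 * (b * b) \<le> a * b" using mult_right_mono[OF ab(5,4)] by simp
    have 2: "0 \<le> b * b" by simp
    have 3: "(a - 9728 * b)\<^sup>2 = a * a - 19456 * (a * b) + 94633984 * (b * b)"
      by (simp add: power2_eq_square algebra_simps)
    have 4: "Z - 19456 * X + 94633984 * Y \<le> Z - 4832 * (X + Y) - 64 * Y"
      if "9728 * Y \<le> X" "0 \<le> Y" for X Y Z :: real using that by simp
    have "(a - 9728 * b)\<^sup>2 \<le> a * a - 4832 * (a * b + b * b) - 64 * (b * b)"
      unfolding 3 by (rule 4[OF 1 2])
    thus ?thesis unfolding \<theta>_def a_def[symmetric] b_def[symmetric] ab(3)
      unfolding ab(1,2)[symmetric] by (simp add: power2_eq_square)
  qed
  have "- H \<subseteq> E1 \<union> E2"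
  proof
    fix w assume "w \<in> - H"
    then obtain x where x: "\<theta>\<^sup>2 * (\<Sum>j<d. (x j)\<^sup>2)
      > (\<Sum>i<n. (app w x i)\<^sup>2) - (\<Sum>k<r. (inner_upto n (v k) (app w x))\<^sup>2)" by (auto simp: H_def not_le)
    define s where "s = (\<Sum>j<d. (x j)\<^sup>2)"
    have "s \<noteq> 0"
    proof
      assume "s = 0"
      hence x0: "x j = 0" if "j < d" for j using that by (simp add: s_def sum_nonneg_eq_0_iff)
      hence "app w x i = 0" for i by (simp add: app_def)
      thus False using x \<open>s = 0\<close> by (simp add: s_def inner_upto_def)
    qed
    hence s: "s > 0" using sum_nonneg[of "{..<d}" "\<lambda>j. (x j)\<^sup>2"] by (simp add: s_def less_le)
    define y where "y = (\<lambda>j. x j / sqrt s)"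
    have y1: "(\<Sum>j<d. (y j)\<^sup>2) = 1"
      using s by (simp add: y_def power_divide sum_divide_distrib[symmetric] s_def[symmetric])
    have ay: "app w y = (\<lambda>i. (1 / sqrt s) * app w x i)"
      by (rule ext) (simp add: app_def y_def sum_divide_distrib)
    have "(\<Sum>i<n. (app w y i)\<^sup>2) = (\<Sum>i<n. (app w x i)\<^sup>2) / s"
      using s by (simp add: ay power_divide sum_divide_distrib)
    moreover have "(\<Sum>k<r. (inner_upto n (v k) (app w y))\<^sup>2) = (\<Sum>k<r. (inner_upto n (v k) (app w x))\<^sup>2) / s"
      unfolding ay inner_upto_scale_right using s by (simp add: power_divide sum_divide_distrib)
    moreover have "\<theta>\<^sup>2 > ((\<Sum>i<n. (app w x i)\<^sup>2) - (\<Sum>k<r. (inner_upto n (v k) (app w x))\<^sup>2)) / s"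
      using x s by (simp add: s_def[symmetric] field_simps)
    ultimately have "\<theta>\<^sup>2 > (\<Sum>i<n. (app w y i)\<^sup>2) - (\<Sum>k<r. (inner_upto n (v k) (app w y))\<^sup>2)"
      by (simp add: diff_divide_distrib)
    hence "\<bar>(\<Sum>i<n. (app w y i)\<^sup>2) - N * (\<Sum>j<d. (y j)\<^sup>2)\<bar> > 4832 * (sqrt (N * t) + t) \<or>
        (\<Sum>k<r. (inner_upto n (v k) (app w y))\<^sup>2) > 64 * t"
      using arith y1 by (simp only: mult_1_right) linarith
    thus "w \<in> E1 \<union> E2" using y1 unfolding E1_def E2_def by (blast intro: order.refl eq_refl)
  qed
  hence "measure_pmf.prob law (- H) \<le> measure_pmf.prob law (E1 \<union> E2)"
    by (intro measure_pmf.finite_measure_mono) auto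
  also have "\<dots> \<le> measure_pmf.prob law E1 + measure_pmf.prob law E2"
    by (intro measure_subadditive) (auto simp: measure_pmf.emeasure_eq_measure)
  also have "\<dots> \<le> 2 * exp (66 * real d - t) + 2 * exp (66 * real (d + r) - t)"
    unfolding E1_def E2_def by (intro add_mono prob_quadratic_deviation prob_projection_large var v t)
  also have "\<dots> \<le> 2 * exp (- 1 - u\<^sup>2) + 2 * exp (- 1 - u\<^sup>2)"
    using d by (intro add_mono mult_left_mono) (auto simp: t_def)
  also have "\<dots> = 4 * exp (- 1) * exp (- u\<^sup>2)" by (simp add: exp_diff exp_minus field_simps)
  also have "\<dots> \<le> 2 * exp (- u\<^sup>2)"
    using exp_ge_add_one_self[of "1::real"] by (intro mult_right_mono) (auto simp: exp_minus field_simps)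
  finally have "measure_pmf.prob law (- H) \<le> 2 * exp (- u\<^sup>2)" .
  moreover have "measure_pmf.prob law (- H) = 1 - measure_pmf.prob law H"
    using measure_pmf.prob_compl[of H law] by (simp add: Compl_eq_Diff_UNIV)
  ultimately show ?thesis by (simp add: H_def)
qed

end

subsection \<open>Stochastic rounding\<close>

lemma exists_grid_cell:
  assumes R: "R > 0" and B: "B \<ge> 1" and x: "\<bar>x\<bar> \<le> R"
  obtains k where "1 \<le> k" "k < 2 ^ B" "grid_point R B k \<le> x" "x \<le> grid_point R B (k + 1)"
proof -
  define \<rho> where "\<rho> = resolution R B"
  have \<rho>: "\<rho> > 0" unfolding \<rho>_def using R B by (rule resolution_pos)
  have M: "(2::nat) ^ B \<ge> 2" using B self_le_power[of "2::nat" B] by simp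
  show ?thesis
  proof (cases "x = R")
    case True
    \<comment> \<open>At the right endpoint the floor formula of the other case would give
      \<open>k = 2 ^ B\<close>, one past the last cell.\<close>
    define k :: nat where "k = 2 ^ B - 1"
    have k: "k + 1 = 2 ^ B" using M by (simp add: k_def)
    show ?thesis
    proof (rule that)
      show "1 \<le> k" "k < 2 ^ B" using M by (auto simp: k_def)
      show "x \<le> grid_point R B (k + 1)" unfolding k using grid_point_ends(2)[OF B, of R] True by simp
      have "grid_point R B k \<le> grid_point R B (k + 1)"
        using \<rho> by (simp add: grid_point_def \<rho>_def[symmetric] mult_right_mono)
      thus "grid_point R B k \<le> x" unfolding k using grid_point_ends(2)[OF B, of R] True by simp
    qed
  next
    case False
    define q where "q = (x + R) / \<rho>"
    have q0: "q \<ge> 0" using x \<rho> by (auto simp: q_def abs_le_iff intro!: divide_nonneg_pos)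
    define k where "k = nat \<lfloor>q\<rfloor> + 1"
    have k: "real k - 1 \<le> q" "q \<le> real k" using q0 by (auto simp: k_def) linarith+
    have "(2::real) ^ B > 1" using B by (intro one_less_power) auto
    hence Mr: "(real (2 ^ B) - 1) * \<rho> = 2 * R" by (simp add: \<rho>_def resolution_def)
    have "q * \<rho> = x + R" using \<rho> by (simp add: q_def)
    also have "\<dots> < (real (2 ^ B) - 1) * \<rho>" unfolding Mr using x False by auto
    finally have "q < real (2 ^ B) - 1" using \<rho> by simp
    hence "real k < real (2 ^ B)" using k by linarith
    hence k2: "k < 2 ^ B" by (simp only: of_nat_less_iff)
    have qx: "x = - R + q * \<rho>" using \<rho> by (simp add: q_def)
    show ?thesis
    proof (rule that)
      show "1 \<le> k" by (simp add: k_def)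
      show "k < 2 ^ B" by (rule k2)
      show "grid_point R B k \<le> x" "x \<le> grid_point R B (k + 1)"
        using k \<rho> by (auto simp: grid_point_def \<rho>_def[symmetric] qx intro!: mult_right_mono)
    qed
  qed
qed

lemma stoch_round_properties:
  assumes R: "R > 0" and B: "B \<ge> 1" and x: "\<bar>x\<bar> \<le> R"
  shows "finite (set_pmf (stoch_round R B x))"
    and "y \<in> set_pmf (stoch_round R B x) \<Longrightarrow> \<bar>y - x\<bar> \<le> resolution R B"
    and "measure_pmf.expectation (stoch_round R B x) (\<lambda>y. y - x) = 0"
proof -
  obtain k where k: "1 \<le> k" "k < 2 ^ B" "grid_point R B k \<le> x" "x \<le> grid_point R B (k + 1)"
    using exists_grid_cell[OF R B x] by blast
  define \<rho> where "\<rho> = resolution R B"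
  have \<rho>: "\<rho> > 0" unfolding \<rho>_def using R B by (rule resolution_pos)
  define g where "g = grid_point R B k"
  have g1: "grid_point R B (k + 1) = g + \<rho>"
    by (simp add: grid_point_def g_def \<rho>_def algebra_simps)
  have gx: "g \<le> x" "x \<le> g + \<rho>" using k g1 by (auto simp: g_def)
  have eq: "stoch_round R B x = map_pmf (\<lambda>up. if up then g + \<rho> else g) (bernoulli_pmf ((x - g) / \<rho>))"
    using stoch_round_eq[OF R B k] by (simp only: g1 g_def[symmetric] \<rho>_def[symmetric])
  have p: "(x - g) / \<rho> \<in> {0..1}" using gx \<rho> by (auto simp: field_simps)
  show "finite (set_pmf (stoch_round R B x))" unfolding eq by simp
  show "\<bar>y - x\<bar> \<le> resolution R B" if "y \<in> set_pmf (stoch_round R B x)"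
    using that gx unfolding eq by (auto simp: \<rho>_def[symmetric] split: if_splits)
  show "measure_pmf.expectation (stoch_round R B x) (\<lambda>y. y - x) = 0"
    unfolding eq using p \<rho> by (simp add: field_simps)
qed

lemma expectation_stoch_round_mat_entry:
  fixes h :: "real \<Rightarrow> real"
  assumes A: "A \<in> carrier_mat n d" and i: "i < n" and j: "j < d"
  shows "measure_pmf.expectation (stoch_round_mat R B A) (\<lambda>A'. h ((A' - A) $$ (i, j)))
    = measure_pmf.expectation (stoch_round R B (A $$ (i, j))) (\<lambda>y. h (y - A $$ (i, j)))"
proof -
  let ?P = "Pi_pmf ({..<n} \<times> {..<d}) 0 (\<lambda>ij. stoch_round R B (A $$ ij))"
  have "measure_pmf.expectation (stoch_round_mat R B A) (\<lambda>A'. h ((A' - A) $$ (i, j)))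
      = measure_pmf.expectation ?P (\<lambda>w. h (w (i, j) - A $$ (i, j)))"
    using A i j by (simp add: stoch_round_mat_def)
  also have "\<dots> = measure_pmf.expectation (map_pmf (\<lambda>w. w (i, j)) ?P) (\<lambda>y. h (y - A $$ (i, j)))" by simp
  also have "map_pmf (\<lambda>w. w (i, j)) ?P = stoch_round R B (A $$ (i, j))"
    using i j by (subst Pi_pmf_component) auto
  finally show ?thesis .
qed

lemma err_var_eq:
  assumes A: "A \<in> carrier_mat n d" and i: "i < n" and j: "j < d"
    and R: "R > 0" and B: "B \<ge> 1" and AR: "\<bar>A $$ (i, j)\<bar> \<le> R"
  shows "err_var R B A i j = measure_pmf.expectation (stoch_round R B (A $$ (i, j))) (\<lambda>y. (y - A $$ (i, j))\<^sup>2)"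
proof -
  have "measure_pmf.expectation (stoch_round_mat R B A) (\<lambda>A'. (A' - A) $$ (i, j)) = 0"
    using expectation_stoch_round_mat_entry[OF A i j, of R B "\<lambda>x. x"] stoch_round_properties(3)[OF R B AR] by simp
  thus ?thesis
    using expectation_stoch_round_mat_entry[OF A i j, of R B "\<lambda>x. x\<^sup>2"] by (simp add: err_var_def)
qed

lemma err_var_nonneg: "err_var R B A i j \<ge> 0"
  unfolding err_var_def by (intro Bochner_Integration.integral_nonneg) simp

lemma mu_nonneg:
  assumes "dim_row A > 0"
  shows "mu R B A \<ge> 0"
proof -
  have "row_var R B A 0 \<ge> 0" unfolding row_var_def by (intro sum_nonneg err_var_nonneg)
  also have "row_var R B A 0 \<le> Max (row_var R B A ` {..<dim_row A})" using assms by (intro Max_ge) auto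
  finally show ?thesis by (simp add: mu_def)
qed

section \<open>Lower bound for the smallest singular value of the rounded matrix\<close>

lemma singular_value_stoch_round_ge:
  fixes A :: "real mat" and u :: real
  assumes nd: "d < n" "d \<ge> 1" and A: "A \<in> carrier_mat n d" and rank: "vec_space.rank n A = r"
    and R: "R > 0" and B: "B \<ge> 1" and AR: "\<And>i j. i < n \<Longrightarrow> j < d \<Longrightarrow> \<bar>A $$ (i, j)\<bar> \<le> R"
  defines "\<theta> \<equiv> sqrt (real n * nu R B A) - 9728 * sqrt (67 * real (d + r) + u\<^sup>2)"
  shows "measure_pmf.prob (stoch_round_mat R B A) {A'. singular_value d A' \<ge> resolution R B * \<theta>}
    \<ge> 1 - 2 * exp (- u\<^sup>2)"
proof -
  define P where "P = Pi_pmf ({..<n} \<times> {..<d}) 0 (\<lambda>ij. stoch_round R B (A $$ ij))"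
  define \<rho> where "\<rho> = resolution R B"
  have \<rho>: "\<rho> > 0" unfolding \<rho>_def using R B by (rule resolution_pos)
  have dims: "dim_row A = n" "dim_col A = d" using A by auto
  have prob_eq: "measure_pmf.prob (stoch_round_mat R B A) {A'. singular_value d A' \<ge> \<rho> * \<theta>}
      = measure_pmf.prob P {w. singular_value d (Matrix.mat n d w) \<ge> \<rho> * \<theta>}"
    unfolding stoch_round_mat_def dims P_def by (simp add: vimage_def)
  show ?thesis
  proof (cases "\<theta> \<le> 0")
    case True
    have "\<rho> * \<theta> \<le> singular_value d (Matrix.mat n d w)" for w
    proof -
      have "\<rho> * \<theta> \<le> 0" using True \<rho> by (simp add: mult_nonneg_nonpos)
      also have "0 \<le> singular_value d (Matrix.mat n d w)"
        using nd by (intro singular_value_ge[where n = n]) (auto intro: sum_nonneg)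
      finally show ?thesis .
    qed
    hence "measure_pmf.prob P {w. singular_value d (Matrix.mat n d w) \<ge> \<rho> * \<theta>} = 1" by simp
    thus ?thesis using prob_eq by (simp add: \<rho>_def)
  next
    case False
    define \<nu> where "\<nu> = (\<lambda>j. col_var R B A j)"
    define N where "N = real n * nu R B A"
    have N: "N = Min (\<nu> ` {..<d}) / \<rho>\<^sup>2" using nd by (simp add: N_def nu_def dims \<nu>_def \<rho>_def)
    \<comment> \<open>Positivity of \<open>\<theta>\<close> excludes a column without variance, so
      the quotients defining \<open>c\<close> are meaningful.\<close>
    have N0: "N > 0" using False by (smt (verit) N_def \<theta>_def real_sqrt_gt_0_iff real_sqrt_ge_0_iff
        mult_nonneg_nonneg of_nat_0_le_iff zero_le_power2)
    have \<nu>: "\<nu> j \<ge> N * \<rho>\<^sup>2" if "j < d" for j using that \<rho> by (simp add: N)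
    have N\<rho>: "N * \<rho>\<^sup>2 > 0" using N0 \<rho> by simp
    have \<nu>0: "\<nu> j > 0" if "j < d" for j using \<nu>[OF that] N\<rho> by linarith
    \<comment> \<open>Scaling column \<open>j\<close> of the error by \<open>c j / \<rho>\<close>
      changes its variance from \<open>\<nu> j\<close> to \<open>N\<close>;
      \<open>c j \<le> 1\<close> because \<open>N * \<rho>^2\<close> is the smallest
      \<open>\<nu> j\<close>, and so the entries stay bounded by \<open>1\<close>.\<close>
    define c where "c = (\<lambda>j. sqrt (N * \<rho>\<^sup>2 / \<nu> j))"
    have c: "0 < c j" "c j \<le> 1" "(c j)\<^sup>2 = N * \<rho>\<^sup>2 / \<nu> j" if "j < d" for j
      using \<nu>[OF that] \<nu>0[OF that] N\<rho> by (auto simp: c_def)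
    define f where "f = (\<lambda>(i, j) y. c j * (y - A $$ (i, j)) / \<rho>)"
    interpret random_matrix n d "\<lambda>ij. stoch_round R B (A $$ ij)" f 0
    proof
      show "1 \<le> d" by (rule nd)
      fix ij assume ij: "ij \<in> {..<n} \<times> {..<d}"
      obtain i j where ij': "ij = (i, j)" "i < n" "j < d" using ij by auto
      have a: "\<bar>A $$ ij\<bar> \<le> R" using AR ij' by simp
      show "finite (set_pmf (stoch_round R B (A $$ ij)))" by (rule stoch_round_properties(1)[OF R B a])
      have "measure_pmf.expectation (stoch_round R B (A $$ ij)) (f ij)
        = measure_pmf.expectation (stoch_round R B (A $$ ij)) (\<lambda>y. c j / \<rho> * (y - A $$ ij))"
        by (simp add: f_def ij')
      also have "\<dots> = c j / \<rho> * measure_pmf.expectation (stoch_round R B (A $$ ij)) (\<lambda>y. y - A $$ ij)"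
        by (rule integral_mult_right_zero)
      finally show "measure_pmf.expectation (stoch_round R B (A $$ ij)) (f ij) = 0"
        by (simp only: stoch_round_properties(3)[OF R B a] mult_zero_right)
      fix y assume y: "y \<in> set_pmf (stoch_round R B (A $$ ij))"
      have "\<bar>f ij y\<bar> = c j * (\<bar>y - A $$ ij\<bar> / \<rho>)" using c[OF ij'(3)] \<rho> by (simp add: f_def ij' abs_mult)
      also have "\<dots> \<le> 1 * 1"
        using c[OF ij'(3)] \<rho> stoch_round_properties(2)[OF R B a y] by (intro mult_mono) (auto simp: \<rho>_def)
      finally show "\<bar>f ij y\<bar> \<le> 1" by simp
    qed
    have var: "(\<Sum>i<n. measure_pmf.expectation (stoch_round R B (A $$ (i, j))) (\<lambda>y. (f (i, j) y)\<^sup>2)) = N"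
      if j: "j < d" for j
    proof -
      have "measure_pmf.expectation (stoch_round R B (A $$ (i, j))) (\<lambda>y. (f (i, j) y)\<^sup>2)
          = (c j)\<^sup>2 / \<rho>\<^sup>2 * err_var R B A i j" if i: "i < n" for i
      proof -
        have "measure_pmf.expectation (stoch_round R B (A $$ (i, j))) (\<lambda>y. (f (i, j) y)\<^sup>2)
          = measure_pmf.expectation (stoch_round R B (A $$ (i, j))) (\<lambda>y. (c j)\<^sup>2 / \<rho>\<^sup>2 * (y - A $$ (i, j))\<^sup>2)"
          by (simp add: f_def power_divide power_mult_distrib)
        also have "\<dots> = (c j)\<^sup>2 / \<rho>\<^sup>2 * err_var R B A i j"
          unfolding err_var_eq[OF A i j R B AR[OF i j]] by (rule integral_mult_right_zero)
        finally show ?thesis .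
      qed
      hence "(\<Sum>i<n. measure_pmf.expectation (stoch_round R B (A $$ (i, j))) (\<lambda>y. (f (i, j) y)\<^sup>2))
          = (c j)\<^sup>2 / \<rho>\<^sup>2 * \<nu> j"
        by (simp add: \<nu>_def col_var_def dims sum_distrib_left)
      also have "\<dots> = N" using c(3)[OF j] \<nu>0[OF j] \<rho> by simp
      finally show ?thesis .
    qed
    obtain r' v where r': "r' \<le> r" and v: "orthonormal n r' v"
      and proj: "\<And>x i. i < n \<Longrightarrow> projection n r' v (\<lambda>i. \<Sum>j<d. A $$ (i, j) * x j) i = (\<Sum>j<d. A $$ (i, j) * x j)"
      using exists_orthonormal_column_space[OF A rank] by blast
    define \<theta>' where "\<theta>' = sqrt N - 9728 * sqrt (67 * real (d + r') + u\<^sup>2)"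
    have \<theta>': "\<theta> \<le> \<theta>'" using r' by (simp add: \<theta>_def \<theta>'_def N_def)
    define H where "H = {w. \<forall>x. \<theta>'\<^sup>2 * (\<Sum>j<d. (x j)\<^sup>2)
      \<le> (\<Sum>i<n. (app w x i)\<^sup>2) - (\<Sum>k<r'. (inner_upto n (v k) (app w x))\<^sup>2)}"
    have "1 - 2 * exp (- u\<^sup>2) \<le> measure_pmf.prob P H"
      unfolding H_def \<theta>'_def P_def
      by (rule prob_projected_norm_ge[OF var v]) (use False \<theta>' \<theta>'_def in auto)
    also have "\<dots> \<le> measure_pmf.prob P {w. singular_value d (Matrix.mat n d w) \<ge> \<rho> * \<theta>}"
    proof (rule measure_pmf.finite_measure_mono)
      show "H \<subseteq> {w. singular_value d (Matrix.mat n d w) \<ge> \<rho> * \<theta>}"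
      proof
        fix w assume w: "w \<in> H"
        have "\<rho> * \<theta> \<le> \<rho> * \<theta>'" using \<theta>' \<rho> by simp
        also have "\<dots> \<le> singular_value d (Matrix.mat n d w)"
        proof (rule singular_value_ge)
          show "Matrix.mat n d w \<in> carrier_mat n d" by simp
          show "1 \<le> d" by (rule nd)
          show "0 \<le> \<rho> * \<theta>'" using \<rho> False \<theta>' by simp
          fix x :: "nat \<Rightarrow> real" assume x: "(\<Sum>j<d. (x j)\<^sup>2) = 1"
          \<comment> \<open>This undoes the shrinking: \<open>\<rho> * app w y\<close> is exactly
            the error matrix applied to \<open>x\<close>, and \<open>y\<close> is at least as long
            as \<open>x\<close>.\<close>
          define y where "y = (\<lambda>j. x j / c j)"
          define a where "a = (\<lambda>i. \<Sum>j<d. A $$ (i, j) * x j)"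
          define e where "e = (\<lambda>i. \<rho> * app w y i)"
          have entries: "a i + e i = (\<Sum>j<d. Matrix.mat n d w $$ (i, j) * x j)" if i: "i < n" for i
          proof -
            have "e i = (\<Sum>j<d. (w (i, j) - A $$ (i, j)) * x j)"
              unfolding e_def app_def sum_distrib_left
            proof (intro sum.cong refl)
              fix j assume "j \<in> {..<d}"
              hence "c j > 0" using c by simp
              thus "\<rho> * (f (i, j) (w (i, j)) * y j) = (w (i, j) - A $$ (i, j)) * x j"
                using \<rho> by (simp add: f_def y_def)
            qed
            thus ?thesis using i by (simp add: a_def sum.distrib[symmetric] algebra_simps)
          qed
          have "1 \<le> (\<Sum>j<d. (y j)\<^sup>2)" unfolding x[symmetric]
          proof (rule sum_mono)
            fix j assume "j \<in> {..<d}"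
            hence cj: "0 < c j" "c j \<le> 1" using c by auto
            have "(x j)\<^sup>2 / 1 \<le> (x j)\<^sup>2 / (c j)\<^sup>2" using cj by (intro divide_left_mono) (auto simp: power_le_one)
            thus "(x j)\<^sup>2 \<le> (y j)\<^sup>2" by (simp add: y_def power_divide)
          qed
          hence "\<theta>'\<^sup>2 * 1 \<le> \<theta>'\<^sup>2 * (\<Sum>j<d. (y j)\<^sup>2)" by (intro mult_left_mono) auto
          also have "\<dots> \<le> (\<Sum>i<n. (app w y i)\<^sup>2) - (\<Sum>k<r'. (inner_upto n (v k) (app w y))\<^sup>2)"
            using w by (auto simp: H_def)
          finally have "\<rho>\<^sup>2 * \<theta>'\<^sup>2 \<le> \<rho>\<^sup>2 * ((\<Sum>i<n. (app w y i)\<^sup>2) - (\<Sum>k<r'. (inner_upto n (v k) (app w y))\<^sup>2))"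
            by (intro mult_left_mono) auto
          also have "\<dots> = inner_upto n e e - (\<Sum>k<r'. (inner_upto n (v k) e)\<^sup>2)"
            unfolding e_def inner_upto_scale_right
            by (simp add: right_diff_distrib power_mult_distrib sum_distrib_left inner_upto_def power2_eq_square mult_ac)
          also have "\<dots> \<le> inner_upto n (\<lambda>i. a i + e i) (\<lambda>i. a i + e i)"
            by (rule norm_perturbation_ge[OF v]) (use proj a_def in auto)
          also have "\<dots> = (\<Sum>i<n. (\<Sum>j<d. Matrix.mat n d w $$ (i, j) * x j)\<^sup>2)"
            unfolding inner_upto_def power2_eq_square by (intro sum.cong refl arg_cong2[of _ _ _ _ "(*)"] entries) auto
          finally show "(\<rho> * \<theta>')\<^sup>2 \<le> (\<Sum>i<n. (\<Sum>j<d. Matrix.mat n d w $$ (i, j) * x j)\<^sup>2)"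
            by (simp add: power_mult_distrib)
        qed
        finally show "w \<in> {w. singular_value d (Matrix.mat n d w) \<ge> \<rho> * \<theta>}" by simp
      qed
    qed simp
    finally show ?thesis using prob_eq by (simp add: \<rho>_def)
  qed
qed

theorem mainTheorem1:
  shows "\<exists>C\<^sub>1 > (0::real). \<exists>c\<^sub>1 > (0::real). \<forall>a > (0::real). \<exists>C\<^sub>a > (0::real).
    \<forall>(n::nat) (d::nat) (r::nat) (A::real mat) (R::real) (B::nat) (u::real).
      n > d \<longrightarrow> d \<ge> 1 \<longrightarrow> A \<in> carrier_mat n d \<longrightarrow> vec_space.rank n A = r \<longrightarrow>
      R > 0 \<longrightarrow> B \<ge> 1 \<longrightarrow> (\<forall>i<n. \<forall>j<d. \<bar>A $$ (i, j)\<bar> \<le> R) \<longrightarrow>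
      kappa R B A \<ge> ln (real n) \<longrightarrow> u \<ge> 0 \<longrightarrow>
      measure_pmf.prob (stoch_round_mat R B A)
        {A'. singular_value d A' \<ge> resolution R B *
               (sqrt (real n * nu R B A) - sqrt (mu R B A)
                - C\<^sub>a * kappa R B A powr (1 / 3) * ln (real n) powr (2 / 3)
                - C\<^sub>1 * (sqrt (real (d + r)) + u))}
      \<ge> 1 - real n powr (- a) - 2 * exp (- c\<^sub>1 * u\<^sup>2)"
proof -
  have bound: "measure_pmf.prob (stoch_round_mat R B A)
        {A'. singular_value d A' \<ge> resolution R B *
               (sqrt (real n * nu R B A) - sqrt (mu R B A)
                - 1 * kappa R B A powr (1 / 3) * ln (real n) powr (2 / 3)
                - 87552 * (sqrt (real (d + r)) + u))}
      \<ge> 1 - real n powr (- a) - 2 * exp (- 1 * u\<^sup>2)"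
    if nd: "n > d" "d \<ge> 1" and A: "A \<in> carrier_mat n d" and rank: "vec_space.rank n A = r"
      and R: "R > 0" and B: "B \<ge> 1" and AR: "\<forall>i<n. \<forall>j<d. \<bar>A $$ (i, j)\<bar> \<le> R" and u: "u \<ge> 0"
    for n d r :: nat and A :: "real mat" and R u a :: real and B
  proof -
    define \<theta> where "\<theta> = sqrt (real n * nu R B A) - 9728 * sqrt (67 * real (d + r) + u\<^sup>2)"
    define \<theta>' where "\<theta>' = sqrt (real n * nu R B A) - sqrt (mu R B A)
                - 1 * kappa R B A powr (1 / 3) * ln (real n) powr (2 / 3)
                - 87552 * (sqrt (real (d + r)) + u)"
    \<comment> \<open>Any square at least \<open>67\<close> works as a factor;
      \<open>9^2 = 81\<close> leads to \<open>87552 = 9 * 9728\<close>.\<close>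
    have "67 * real (d + r) + u\<^sup>2 \<le> (9 * (sqrt (real (d + r)) + u))\<^sup>2"
    proof -
      define b where "b = sqrt (real (d + r))"
      have b: "b \<ge> 0" "real (d + r) = b\<^sup>2" by (auto simp: b_def)
      have "0 \<le> b * u" using b u by simp
      thus ?thesis unfolding b_def[symmetric] unfolding b(2) using zero_le_power2[of b] zero_le_power2[of u]
        by (simp add: power2_eq_square algebra_simps)
    qed
    hence "sqrt (67 * real (d + r) + u\<^sup>2) \<le> 9 * (sqrt (real (d + r)) + u)"
      using u by (intro real_le_lsqrt) auto
    moreover have "sqrt (mu R B A) \<ge> 0" using mu_nonneg[of A R B] A nd by auto
    moreover have "kappa R B A powr (1 / 3) * ln (real n) powr (2 / 3) \<ge> 0" by simp
    \<comment> \<open>The terms with \<open>mu\<close> and \<open>kappa\<close> are subtracted and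
      nonnegative, so \<open>\<theta>'\<close> lies below the bound already obtained; this is why
      the value \<open>1\<close> can serve as \<open>C\<^sub>a\<close> for every
      \<open>a\<close>.\<close>
    ultimately have \<theta>: "\<theta>' \<le> \<theta>" unfolding \<theta>_def \<theta>'_def by linarith
    have \<rho>: "resolution R B > 0" using R B by (rule resolution_pos)
    have "1 - real n powr (- a) - 2 * exp (- 1 * u\<^sup>2) \<le> 1 - 2 * exp (- u\<^sup>2)" by simp
    also have "\<dots> \<le> measure_pmf.prob (stoch_round_mat R B A) {A'. singular_value d A' \<ge> resolution R B * \<theta>}"
      unfolding \<theta>_def by (rule singular_value_stoch_round_ge[OF nd A rank R B]) (use AR in auto)
    also have "\<dots> \<le> measure_pmf.prob (stoch_round_mat R B A) {A'. singular_value d A' \<ge> resolution R B * \<theta>'}"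
    proof (rule measure_pmf.finite_measure_mono)
      have "resolution R B * \<theta>' \<le> resolution R B * \<theta>" using \<theta> \<rho> by simp
      thus "{A'. singular_value d A' \<ge> resolution R B * \<theta>} \<subseteq> {A'. singular_value d A' \<ge> resolution R B * \<theta>'}"
        by (blast intro: order_trans)
    qed simp
    finally show ?thesis unfolding \<theta>'_def .
  qed
  show ?thesis
    by (rule exI[of _ "87552::real"], rule conjI, simp, rule exI[of _ "1::real"], rule conjI, simp,
        intro allI impI, rule exI[of _ "1::real"], rule conjI, simp, intro allI impI, rule bound)
qed

end
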